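(* Let $E : \mathrm{L}(\mathbb{C}^p) \to \mathrm{L}(\mathbb{C}^q)$ be a completely positive, trace preserving linear transformation (a CPTP map). Suppose there is a CPTP map $D : \mathrm{L}(\mathbb{C}^q) \to \mathrm{L}(\mathbb{C}^p)$ such that $D(E(\rho)) = \rho$ for all density matrices $\rho \in \mathrm{L}(\mathbb{C}^p)$; that is, $E$ is an invertible quantum operation with inverse $D$. Then there is a density matrix $\omega \in \mathrm{L}(\mathbb{C}^{\lfloor q/p \rfloor})$ and a unitary operation $U$ on $\mathbb{C}^q$ such that $$E(\rho) = U (\rho \otimes \omega) U^\dagger$$ for all density matrices $\rho \in \mathrm{L}(\mathbb{C}^p)$. Furthermore, $D$ corresponds to applying $U^\dagger$ (that is, conjugating $\tau \mapsto U^\dagger \tau U$) and tracing out the $\lfloor q/p \rfloor$-dimensional ancilla.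
   Context: $p,q$ are positive integers. $\mathrm{L}(\mathcal{H})$ denotes the set of linear operators on the Hilbert space $\mathcal{H}$. A density matrix is a positive semi-definite operator of trace $1$. $^\dagger$ denotes the adjoint. The ancilla is the tensor factor $\mathbb{C}^{\lfloor q/p \rfloor}$ on which $\omega$ acts. The operator $\rho\otimes\omega$ on $\mathbb{C}^p\otimes\mathbb{C}^{\lfloor q/p \rfloor}$ is regarded as an operator on $\mathbb{C}^q$ by identifying $\mathbb{C}^p\otimes\mathbb{C}^{\lfloor q/p \rfloor}$ with a subspace of $\mathbb{C}^q$ via a fixed isometric embedding.
   Formalization: The claim that D is conjugation by U† followed by tracing out the ancilla is proved only for density matrices τ whose support lies in the support of some E(ρ); on other inputs D is arbitrary, so the unrestricted claim is false. *)

theory Defs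
  imports
    "Jordan_Normal_Form.Schur_Decomposition"
    "Jordan_Normal_Form.Matrix_Kernel"
begin

text \<open>
  Operators on \<open>\<complex>\<^sup>n\<close> are the elements of \<^term>\<open>carrier_mat n n :: complex mat set\<close>. The order on
  \<^typ>\<open>complex\<close> is that of \<^theory>\<open>HOL-Library.Complex_Order\<close>, so \<open>0 \<le> z\<close> says that
  \<open>z\<close> is real and nonnegative.
\<close>

definition mtrace :: "complex mat \<Rightarrow> complex" where
  "mtrace A = (\<Sum>i<dim_row A. A $$ (i, i))"

definition psd :: "nat \<Rightarrow> complex mat \<Rightarrow> bool" where
  "psd n A \<longleftrightarrow> A \<in> carrier_mat n n \<and> (\<forall>v\<in>carrier_vec n. 0 \<le> (A *\<^sub>v v) \<bullet>c v)"

definition density_matrix :: "nat \<Rightarrow> complex mat \<Rightarrow> bool" where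
  "density_matrix n A \<longleftrightarrow> psd n A \<and> mtrace A = 1"

text \<open>Isometries \<open>\<complex>\<^sup>n \<rightarrow> \<complex>\<^sup>q\<close>.\<close>

definition isometry_mat :: "nat \<Rightarrow> nat \<Rightarrow> complex mat \<Rightarrow> bool" where
  "isometry_mat q n V \<longleftrightarrow> V \<in> carrier_mat q n \<and> mat_adjoint V * V = 1\<^sub>m n"

definition unitary_mat :: "nat \<Rightarrow> complex mat \<Rightarrow> bool" where
  "unitary_mat n U \<longleftrightarrow>
     U \<in> carrier_mat n n \<and> mat_adjoint U * U = 1\<^sub>m n \<and> U * mat_adjoint U = 1\<^sub>m n"

text \<open>
  Throughout, the basis vector \<open>e\<^sub>a \<otimes> e\<^sub>i\<close> of \<open>\<complex>\<^sup>p \<otimes> \<complex>\<^sup>m\<close> has index \<open>a * m + i\<close>.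
\<close>

definition kron :: "complex mat \<Rightarrow> complex mat \<Rightarrow> complex mat" where
  "kron A B = mat (dim_row A * dim_row B) (dim_col A * dim_col B)
     (\<lambda>(r, s). A $$ (r div dim_row B, s div dim_col B) * B $$ (r mod dim_row B, s mod dim_col B))"

text \<open>The partial trace over the second factor of \<open>\<complex>\<^sup>p \<otimes> \<complex>\<^sup>m\<close>.\<close>

definition ptrace2 :: "nat \<Rightarrow> nat \<Rightarrow> complex mat \<Rightarrow> complex mat" where
  "ptrace2 p m A = mat p p (\<lambda>(a, b). \<Sum>i<m. A $$ (a * m + i, b * m + i))"

text \<open>
  The map \<open>E \<otimes> id\<close> from operators on \<open>\<complex>\<^sup>p \<otimes> \<complex>\<^sup>n\<close> to operators on \<open>\<complex>\<^sup>q \<otimes> \<complex>\<^sup>n\<close>: writing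
  \<open>A = (\<Sum>i j. A\<^sub>i\<^sub>j \<otimes> |i\<rangle>\<langle>j|)\<close>, its value at \<open>A\<close> is \<open>(\<Sum>i j. E A\<^sub>i\<^sub>j \<otimes> |i\<rangle>\<langle>j|)\<close>.
\<close>

definition tensor_id ::
    "nat \<Rightarrow> nat \<Rightarrow> nat \<Rightarrow> (complex mat \<Rightarrow> complex mat) \<Rightarrow> complex mat \<Rightarrow> complex mat" where
  "tensor_id p q n E A = mat (q * n) (q * n) (\<lambda>(r, s).
     E (mat p p (\<lambda>(a, b). A $$ (a * n + r mod n, b * n + s mod n))) $$ (r div n, s div n))"

text \<open>
  A map \<open>L(\<complex>\<^sup>p) \<rightarrow> L(\<complex>\<^sup>q)\<close> is a HOL function on all complex matrices of which only the values on
  \<^term>\<open>carrier_mat p p\<close> matter.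
\<close>

definition linear_op :: "nat \<Rightarrow> nat \<Rightarrow> (complex mat \<Rightarrow> complex mat) \<Rightarrow> bool" where
  "linear_op p q E \<longleftrightarrow>
     (\<forall>A\<in>carrier_mat p p. E A \<in> carrier_mat q q) \<and>
     (\<forall>A\<in>carrier_mat p p. \<forall>B\<in>carrier_mat p p. E (A + B) = E A + E B) \<and>
     (\<forall>c. \<forall>A\<in>carrier_mat p p. E (c \<cdot>\<^sub>m A) = c \<cdot>\<^sub>m E A)"

definition completely_positive :: "nat \<Rightarrow> nat \<Rightarrow> (complex mat \<Rightarrow> complex mat) \<Rightarrow> bool" where
  "completely_positive p q E \<longleftrightarrow> (\<forall>n A. psd (p * n) A \<longrightarrow> psd (q * n) (tensor_id p q n E A))"

definition trace_preserving :: "nat \<Rightarrow> (complex mat \<Rightarrow> complex mat) \<Rightarrow> bool" where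
  "trace_preserving p E \<longleftrightarrow> (\<forall>A\<in>carrier_mat p p. mtrace (E A) = mtrace A)"

definition cptp :: "nat \<Rightarrow> nat \<Rightarrow> (complex mat \<Rightarrow> complex mat) \<Rightarrow> bool" where
  "cptp p q E \<longleftrightarrow> linear_op p q E \<and> completely_positive p q E \<and> trace_preserving p E"

text \<open>
  For positive semidefinite \<open>\<tau>\<close> and \<open>\<sigma>\<close>: the support of \<open>\<tau>\<close> is contained in that of \<open>\<sigma>\<close>. The
  support is the orthogonal complement of the kernel, which reverses the inclusion.

  A left inverse \<open>D\<close> of \<open>E\<close> on states is determined only where the outputs of \<open>E\<close> live. For
  example, for \<open>E \<rho> = \<rho> \<otimes> |0\<rangle>\<langle>0|\<close> with an ancilla of dimension at least 2, \<open>D\<close> may send every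
  state supported on the orthogonal complement of \<open>\<complex>\<^sup>p \<otimes> |0\<rangle>\<close> to one fixed state. So \<open>D\<close> can only
  be compared with a partial trace on states supported in some \<open>E \<rho>\<close>; the states \<open>E \<rho>\<close>
  themselves are among them.
\<close>

definition supported_in :: "complex mat \<Rightarrow> complex mat \<Rightarrow> bool" where
  "supported_in \<tau> \<sigma> \<longleftrightarrow> mat_kernel \<sigma> \<subseteq> mat_kernel \<tau>"

text \<open>
  The operator on \<open>\<complex>\<^sup>q\<close> that an operator on \<open>\<complex>\<^sup>n\<close> becomes under an isometric embedding \<open>V\<close>
  (zero on the orthogonal complement of the image), and conversely the operator on \<open>\<complex>\<^sup>n\<close>
  obtained from an operator on \<open>\<complex>\<^sup>q\<close> that lives on the image of \<open>V\<close>.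
\<close>

definition embed_op :: "complex mat \<Rightarrow> complex mat \<Rightarrow> complex mat" where
  "embed_op V A = V * A * mat_adjoint V"

definition restrict_op :: "complex mat \<Rightarrow> complex mat \<Rightarrow> complex mat" where
  "restrict_op V B = mat_adjoint V * B * V"

end

theory Submission
  imports Defs
begin

text \<open>
  Let \<open>A\<^sub>k\<close> and \<open>B\<^sub>l\<close> be Kraus operators of \<open>E\<close> and \<open>D\<close>. The operators \<open>B\<^sub>l A\<^sub>k\<close> form a Kraus
  representation of the identity, so each is a scalar. Call \<open>X : \<complex>\<^sup>p \<rightarrow> \<complex>\<^sup>q\<close> correctable if all
  \<open>B\<^sub>l X\<close> are scalar. As \<open>\<Sum>\<^sub>l B\<^sub>l\<^sup>\<dagger> B\<^sub>l = 1\<close>, the product \<open>X\<^sup>\<dagger> Y\<close> is scalar for correctable \<open>X\<close>, \<open>Y\<close>,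
  which makes the correctable operators an inner product space in which Gram-Schmidt can be applied
  to the \<open>A\<^sub>k\<close>. It yields isometries \<open>W\<^sub>i\<close>, \<open>i < r\<close>, with pairwise orthogonal ranges and
  \<open>A\<^sub>k = \<Sum>\<^sub>i g\<^sub>k\<^sub>i W\<^sub>i\<close>. Counting dimensions gives \<open>p r \<le> q\<close>, so some unitary \<open>U\<close> satisfies
  \<open>U V (e\<^sub>a \<otimes> e\<^sub>i) = W\<^sub>i e\<^sub>a\<close>, and \<open>\<omega>\<^sub>i\<^sub>j = \<Sum>\<^sub>k g\<^sub>k\<^sub>i cnj g\<^sub>k\<^sub>j\<close> is the required state; it need not be diagonal.
  A state \<open>\<tau>\<close> supported in some \<open>E \<rho>\<close> satisfies \<open>\<tau> = P \<tau> P\<close> for \<open>P = \<Sum>\<^sub>i W\<^sub>i W\<^sub>i\<^sup>\<dagger>\<close>, and each \<open>B\<^sub>l P\<close> is a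
  combination of the \<open>W\<^sub>i\<^sup>\<dagger>\<close>, whence \<open>D \<tau> = \<Sum>\<^sub>i W\<^sub>i\<^sup>\<dagger> \<tau> W\<^sub>i\<close>.
\<close>

subsection \<open>Adjoints and finite sums of matrices\<close>

lemma index_mat_adjoint [simp]:
  "i < dim_col A \<Longrightarrow> j < dim_row A \<Longrightarrow> mat_adjoint A $$ (i, j) = cnj (A $$ (j, i))"
  for A :: "complex mat"
  unfolding mat_adjoint_def by (simp add: mat_of_rows_def)

lemma dim_mat_adjoint [simp]:
  "dim_row (mat_adjoint A) = dim_col A" "dim_col (mat_adjoint A) = dim_row A"
  for A :: "complex mat"
  unfolding mat_adjoint_def by simp_all

lemma mat_adjoint_carrier [simp, intro]:
  "A \<in> carrier_mat n m \<Longrightarrow> mat_adjoint A \<in> carrier_mat m n" for A :: "complex mat"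
  by auto

lemma index_mult_mat_sum:
  assumes "A \<in> carrier_mat n m" "B \<in> carrier_mat m l" "i < n" "j < l"
  shows "(A * B) $$ (i, j) = (\<Sum>k<m. A $$ (i, k) * B $$ (k, j))"
  using assms by (auto simp: scalar_prod_def lessThan_atLeast0)

lemma mat_adjoint_mult:
  fixes A B :: "complex mat"
  assumes "A \<in> carrier_mat n m" "B \<in> carrier_mat m l"
  shows "mat_adjoint (A * B) = mat_adjoint B * mat_adjoint A"
proof (rule eq_matI)
  fix i j assume "i < dim_row (mat_adjoint B * mat_adjoint A)" "j < dim_col (mat_adjoint B * mat_adjoint A)"
  then have ij: "i < l" "j < n" using assms by auto
  show "mat_adjoint (A * B) $$ (i, j) = (mat_adjoint B * mat_adjoint A) $$ (i, j)"
    using assms ij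
    by (simp add: index_mult_mat_sum[of _ l m _ n] index_mult_mat_sum[of _ n m _ l] mult.commute
        del: index_mult_mat(1))
qed (use assms in auto)

lemma mat_adjoint_mat_adjoint [simp]: "mat_adjoint (mat_adjoint A) = A" for A :: "complex mat"
  by (rule eq_matI) auto

lemma mat_adjoint_smult: "mat_adjoint (c \<cdot>\<^sub>m A) = cnj c \<cdot>\<^sub>m mat_adjoint A" for A :: "complex mat"
  by (rule eq_matI) auto

lemma mat_adjoint_one [simp]: "mat_adjoint (1\<^sub>m n) = (1\<^sub>m n :: complex mat)"
  by (rule eq_matI) auto

lemma mat_adjoint_zero [simp]: "mat_adjoint (0\<^sub>m n m) = (0\<^sub>m m n :: complex mat)"
  by (rule eq_matI) auto

lemma smult_smult_mat: "a \<cdot>\<^sub>m (b \<cdot>\<^sub>m A) = (a * b) \<cdot>\<^sub>m A" for a b :: "'a :: semigroup_mult"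
  by (rule eq_matI) (auto simp: mult.assoc)

text \<open>Matrices of all sizes share one type and each size has its own zero, so the dimensions
  are carried explicitly; the empty sum then has a definite size.\<close>

definition msum :: "nat \<Rightarrow> nat \<Rightarrow> ('k \<Rightarrow> complex mat) \<Rightarrow> 'k set \<Rightarrow> complex mat" where
  "msum n m f I = mat n m (\<lambda>ij. \<Sum>k\<in>I. f k $$ ij)"

lemma msum_carrier [simp, intro]: "msum n m f I \<in> carrier_mat n m"
  by (simp add: msum_def)

lemma dim_msum [simp]: "dim_row (msum n m f I) = n" "dim_col (msum n m f I) = m"
  by (simp_all add: msum_def)

lemma index_msum [simp]:
  "i < n \<Longrightarrow> j < m \<Longrightarrow> msum n m f I $$ (i, j) = (\<Sum>k\<in>I. f k $$ (i, j))"
  by (simp add: msum_def)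

lemma msum_cong: "(\<And>k. k \<in> I \<Longrightarrow> f k = g k) \<Longrightarrow> msum n m f I = msum n m g I"
  by (auto simp: msum_def)

lemma msum_insert:
  assumes "finite I" "k \<notin> I" "f k \<in> carrier_mat n m"
  shows "msum n m f (insert k I) = f k + msum n m f I"
  by (rule eq_matI) (use assms in auto)

lemma msum_empty [simp]: "msum n m f {} = 0\<^sub>m n m"
  by (rule eq_matI) auto

lemma mult_msum:
  assumes "A \<in> carrier_mat n m" "\<And>k. k \<in> I \<Longrightarrow> f k \<in> carrier_mat m l"
  shows "A * msum m l f I = msum n l (\<lambda>k. A * f k) I"
proof (rule eq_matI)
  fix i j assume "i < dim_row (msum n l (\<lambda>k. A * f k) I)" "j < dim_col (msum n l (\<lambda>k. A * f k) I)"
  then have ij: "i < n" "j < l" by auto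
  have "(A * msum m l f I) $$ (i, j) = (\<Sum>h<m. A $$ (i, h) * (\<Sum>k\<in>I. f k $$ (h, j)))"
    by (subst index_mult_mat_sum[OF assms(1) msum_carrier ij]) (use ij in simp)
  also have "\<dots> = (\<Sum>k\<in>I. \<Sum>h<m. A $$ (i, h) * f k $$ (h, j))"
    unfolding sum_distrib_left by (rule sum.swap)
  also have "\<dots> = (\<Sum>k\<in>I. (A * f k) $$ (i, j))"
    by (intro sum.cong refl, subst index_mult_mat_sum[OF assms(1) assms(2) ij]) auto
  finally show "(A * msum m l f I) $$ (i, j) = msum n l (\<lambda>k. A * f k) I $$ (i, j)"
    using ij by simp
qed (use assms in auto)

lemma msum_mult:
  assumes "A \<in> carrier_mat m l" "\<And>k. k \<in> I \<Longrightarrow> f k \<in> carrier_mat n m"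
  shows "msum n m f I * A = msum n l (\<lambda>k. f k * A) I"
proof (rule eq_matI)
  fix i j assume "i < dim_row (msum n l (\<lambda>k. f k * A) I)" "j < dim_col (msum n l (\<lambda>k. f k * A) I)"
  then have ij: "i < n" "j < l" by auto
  have "(msum n m f I * A) $$ (i, j) = (\<Sum>h<m. (\<Sum>k\<in>I. f k $$ (i, h)) * A $$ (h, j))"
    by (subst index_mult_mat_sum[OF msum_carrier assms(1) ij]) (use ij in simp)
  also have "\<dots> = (\<Sum>k\<in>I. \<Sum>h<m. f k $$ (i, h) * A $$ (h, j))"
    unfolding sum_distrib_right by (rule sum.swap)
  also have "\<dots> = (\<Sum>k\<in>I. (f k * A) $$ (i, j))"
    by (intro sum.cong refl, subst index_mult_mat_sum[OF assms(2) assms(1) ij]) auto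
  finally show "(msum n m f I * A) $$ (i, j) = msum n l (\<lambda>k. f k * A) I $$ (i, j)"
    using ij by simp
qed (use assms in auto)

lemma mat_adjoint_msum:
  assumes "\<And>k. k \<in> I \<Longrightarrow> f k \<in> carrier_mat n m"
  shows "mat_adjoint (msum n m f I) = msum m n (\<lambda>k. mat_adjoint (f k)) I"
proof (rule eq_matI)
  fix i j assume "i < dim_row (msum m n (\<lambda>k. mat_adjoint (f k)) I)"
    "j < dim_col (msum m n (\<lambda>k. mat_adjoint (f k)) I)"
  then have ij: "i < m" "j < n" by auto
  then show "mat_adjoint (msum n m f I) $$ (i, j) = msum m n (\<lambda>k. mat_adjoint (f k)) I $$ (i, j)"
    using assms by (auto intro!: sum.cong index_mat_adjoint[symmetric] dest!: assms)
qed auto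

lemma msum_smult_const:
  assumes "X \<in> carrier_mat n m"
  shows "msum n m (\<lambda>k. c k \<cdot>\<^sub>m X) I = (\<Sum>k\<in>I. c k) \<cdot>\<^sub>m X"
  by (rule eq_matI) (use assms in \<open>auto simp: sum_distrib_right\<close>)

lemma msum_delta:
  assumes "finite I" "j \<in> I" "f j \<in> carrier_mat n m"
    "\<And>k. k \<in> I \<Longrightarrow> k \<noteq> j \<Longrightarrow> f k = 0\<^sub>m n m"
  shows "msum n m f I = f j"
proof (rule eq_matI)
  fix a b assume ab: "a < dim_row (f j)" "b < dim_col (f j)"
  have "(\<Sum>k\<in>I. f k $$ (a, b)) = (\<Sum>k\<in>{j}. f k $$ (a, b))"
    by (rule sum.mono_neutral_right) (use assms ab in auto)
  then show "msum n m f I $$ (a, b) = f j $$ (a, b)" using ab assms by simp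
qed (use assms in auto)

subsection \<open>Positive semidefinite forms\<close>

text \<open>Coefficients and arguments are functions on indices rather than matrices and vectors, so
  that the elimination below can pass from size \<open>Suc n\<close> to size \<open>n\<close>
  without forming submatrices.\<close>

abbreviation hform :: "(nat \<Rightarrow> nat \<Rightarrow> complex) \<Rightarrow> nat \<Rightarrow> (nat \<Rightarrow> complex) \<Rightarrow> complex" where
  "hform C n x \<equiv> \<Sum>i<n. \<Sum>j<n. cnj (x i) * C i j * x j"

text \<open>Polarization: a nonnegative form takes real values, and evaluating it at
  \<open>e_i + s e_j\<close> for \<open>s\<close> equal to 0, 1, -1 and \<open>\<i>\<close> yields
  the real linear equations that relate \<open>C i j\<close> to \<open>C j i\<close>.\<close>

lemma hform_nonneg_imp_hermitian:
  assumes pos: "\<And>x. 0 \<le> hform C n x" and ij: "i < n" "j < n"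
  shows "C j i = cnj (C i j)"
proof -
  have val: "hform C n (\<lambda>k. (if k = i then 1 else 0) + (if k = j then s else 0))
      = C i i + s * C i j + cnj s * C j i + cnj s * s * C j j" for s
  proof -
    have if_sum: "(\<Sum>k<n. if P then f k else 0) = (if P then \<Sum>k<n. f k else 0)"
      for P and f :: "nat \<Rightarrow> complex" by simp
    show ?thesis
      using ij by (simp add: if_distrib[of cnj] algebra_simps sum.distrib if_distrib[of "\<lambda>x. _ * x"]
          if_sum cong: if_cong)
  qed
  have im: "Im (C i i + s * C i j + cnj s * C j i + cnj s * s * C j j) = 0" for s
    using pos[of "\<lambda>k. (if k = i then 1 else 0) + (if k = j then s else 0)"] unfolding val
    by (simp add: less_eq_complex_def)
  have "Im (C i i) = 0" using im[of 0] by simp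
  moreover have "Im (C i i + 1 * C i j + C j i + C j j) = 0" "Im (C i i - C i j - C j i + C j j) = 0"
    "Re (C i j) - Re (C j i) + Im (C i i + C j j) = 0"
    using im[of 1] im[of "-1"] im[of \<i>] by (simp_all add: algebra_simps)
  ultimately show ?thesis by (auto simp: complex_eq_iff)
qed

text \<open>
  Cholesky elimination of the last index. If the pivot vanishes then so does its row, and the
  convention \<open>x / 0 = 0\<close> lets both cases share one formula.
\<close>

lemma hform_nonneg_imp_factor:
  assumes "\<And>x. 0 \<le> hform C n x"
  shows "\<exists>v. \<forall>i<n. \<forall>j<n. C i j = (\<Sum>k<n. v k i * cnj (v k j))"
  using assms
proof (induction n arbitrary: C)
  case (Suc n)
  note herm = hform_nonneg_imp_hermitian[of C "Suc n", OF Suc.prems]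
  define c where "c = Re (C n n)"
  have "hform C (Suc n) (\<lambda>k. if k = n then 1 else 0) = C n n"
    by (simp add: if_distrib[of cnj] if_distrib[of "\<lambda>x. _ * x"] if_distrib[of "\<lambda>x. x * _"] cong: if_cong)
  with Suc.prems[of "\<lambda>k. if k = n then 1 else 0"] have "0 \<le> C n n" by metis
  then have c: "C n n = of_real c" "0 \<le> c"
    by (auto simp: c_def less_eq_complex_def complex_eq_iff)
  \<comment> \<open>The form at \<open>y\<close> extended by the last coordinate \<open>t\<close>,
    as a quadratic in \<open>t\<close>. It is used below at \<open>t = 0\<close>, at a large
    multiple of \<open>C n j\<close>, and at the minimizer \<open>- ?z / c\<close>.\<close>
  have split: "hform C n y + 2 * Re (cnj t * (\<Sum>j<n. C n j * y j)) + c * (cmod t)\<^sup>2 \<in> {z. 0 \<le> z}" for y t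
  proof -
    let ?x = "\<lambda>k. if k = n then t else y k"
    let ?z = "\<Sum>j<n. C n j * y j"
    have "hform C (Suc n) ?x = hform C n y + (\<Sum>i<n. cnj (y i) * C i n * t)
        + (cnj t * ?z + cnj t * C n n * t)"
      by (simp add: sum.distrib sum_distrib_left mult.assoc)
    also have "(\<Sum>i<n. cnj (y i) * C i n * t) = cnj ?z * t"
      unfolding cnj_sum sum_distrib_right
      by (intro sum.cong refl) (use herm[of n] in simp)
    also have "hform C n y + cnj ?z * t + (cnj t * ?z + cnj t * C n n * t)
        = hform C n y + (cnj t * ?z + cnj (cnj t * ?z)) + C n n * (t * cnj t)"
      by (simp add: algebra_simps)
    also have "\<dots> = hform C n y + 2 * Re (cnj t * ?z) + c * (cmod t)\<^sup>2"
      unfolding complex_add_cnj complex_norm_square[symmetric] c by simp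
    finally show ?thesis using Suc.prems[of ?x] by (simp only: mem_Collect_eq)
  qed
  \<comment> \<open>With a vanishing pivot the quadratic is affine in \<open>t\<close>, so a nonzero
    linear coefficient would make the form unbounded below.\<close>
  have zero: "C n j = 0" if c0: "c = 0" and j: "j < n" for j
  proof (rule ccontr)
    assume nz: "C n j \<noteq> 0"
    let ?y = "\<lambda>k. if k = j then 1 else 0 :: complex"
    have z: "(\<Sum>k<n. C n k * ?y k) = C n j"
      using j by (simp add: if_distrib[of "\<lambda>x. _ * x"] cong: if_cong)
    define h where "h = Re (hform C n ?y)"
    \<comment> \<open>Chosen so that the linear term contributes
      \<open>- 2 * (\<bar>h\<bar> + 1)\<close>, which outweighs \<open>h\<close>.\<close>
    define s where "s = (\<bar>h\<bar> + 1) / (cmod (C n j))\<^sup>2"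
    have "0 \<le> Re (hform C n ?y + 2 * Re (cnj (- s * C n j) * C n j) + c * (cmod (- s * C n j))\<^sup>2)"
      using split[of ?y "- s * C n j"] unfolding z by (simp only: less_eq_complex_def mem_Collect_eq zero_complex.sel)
    then have "0 \<le> h - 2 * (s * (cmod (C n j))\<^sup>2)"
      unfolding h_def c0 cmod_power2 by (simp add: power2_eq_square algebra_simps)
    also have "s * (cmod (C n j))\<^sup>2 = \<bar>h\<bar> + 1" using nz by (simp add: s_def)
    finally show False using abs_ge_self[of h] abs_ge_zero[of h] by (simp add: algebra_simps)
  qed
  \<comment> \<open>The Schur complement of the pivot; for \<open>c = 0\<close> the quotient is 0
    and \<open>C'\<close> equals \<open>C\<close>.\<close>
  define C' where "C' i j = C i j - C i n * C n j / c" for i j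
  \<comment> \<open>Completing the square: the minimum of the quadratic is attained at
    \<open>- z / c\<close>, so values of the Schur complement are values of the original form and
    inherit nonnegativity.\<close>
  have square: "X - complex_of_real ((cmod z)\<^sup>2) / complex_of_real c = X + 2 * Re (cnj (- z / c) * z) + c * (cmod (- z / c))\<^sup>2"
    if "c \<noteq> 0" for X z
  proof -
    have "cnj (- z / c) * z = - (z * cnj z) / c" by simp
    also have "\<dots> = of_real (- ((cmod z)\<^sup>2) / c)" by (simp only: complex_norm_square[symmetric]) simp
    finally have "Re (cnj (- z / c) * z) = - ((cmod z)\<^sup>2) / c" by (metis Re_complex_of_real)
    moreover have "c * (cmod (- z / c))\<^sup>2 = (cmod z)\<^sup>2 / c"
      using that by (simp add: norm_divide power_divide power2_eq_square)
    ultimately have "2 * Re (cnj (- z / c) * z) + c * (cmod (- z / c))\<^sup>2 = - (cmod z)\<^sup>2 / c"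
      by (simp only:)
    then show ?thesis unfolding add.assoc of_real_add[symmetric] by simp
  qed
  have "0 \<le> hform C' n y" for y
  proof (cases "c = 0")
    case True
    then have "hform C' n y = hform C n y" by (simp add: C'_def)
    then show ?thesis using split[of y 0] by simp
  next
    case False
    let ?z = "\<Sum>j<n. C n j * y j"
    have "cnj ?z = (\<Sum>i<n. cnj (y i) * C i n)"
      unfolding cnj_sum by (intro sum.cong refl) (use herm[of n] in simp)
    then have "hform C' n y = hform C n y - cnj ?z * ?z / c"
      by (simp add: C'_def algebra_simps sum_subtractf sum_distrib_left sum_distrib_right
          sum_divide_distrib sum_product)
    also have "cnj ?z * ?z = complex_of_real ((cmod ?z)\<^sup>2)"
      by (simp only: complex_norm_square mult.commute)
    also have "hform C n y - complex_of_real ((cmod ?z)\<^sup>2) / complex_of_real c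
       = hform C n y + 2 * Re (cnj (- ?z / c) * ?z) + c * (cmod (- ?z / c))\<^sup>2"
      by (rule square[OF False])
    finally show ?thesis using split[of y "- ?z / c"] by (simp only: mem_Collect_eq)
  qed
  from Suc.IH[OF this] obtain v where
    v: "\<And>i j. i < n \<Longrightarrow> j < n \<Longrightarrow> C' i j = (\<Sum>k<n. v k i * cnj (v k j))" by blast
  \<comment> \<open>The new vector is the pivot column divided by the square root of the pivot; the
    vectors of the Schur complement are extended by 0 at index \<open>n\<close>.\<close>
  define w where "w k i = (if k = n then C i n / sqrt c else if i = n then 0 else v k i)" for k i
  have "C i j = (\<Sum>k<Suc n. w k i * cnj (w k j))" if ij: "i < Suc n" "j < Suc n" for i j
  proof -
    have last: "w n i * cnj (w n j) = C i n * C n j / c"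
      using herm[of j n] ij c(2) by (simp add: w_def flip: of_real_mult)
    show ?thesis
    proof (cases "i < n \<and> j < n")
      case True
      have "(\<Sum>k<n. w k i * cnj (w k j)) = C' i j"
        using True v by (simp add: w_def)
      then show ?thesis using last by (simp add: C'_def)
    next
      case False
      then have "(\<Sum>k<n. w k i * cnj (w k j)) = 0" by (intro sum.neutral) (use ij in \<open>auto simp: w_def\<close>)
      moreover have "C i j = C i n * C n j / c"
      proof (cases "c = 0")
        case True
        from False ij have "i = n \<or> j = n" by auto
        moreover have "C n k = 0" if "k < Suc n" for k using zero[OF True, of k] that c True by (cases "k = n") auto
        ultimately show ?thesis using herm[of n i] ij True by auto
      next
        case cn: False
        then show ?thesis using False ij c by (cases "i = n"; cases "j = n") auto
      qed
      ultimately show ?thesis using last by simp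
    qed
  qed
  then show ?case by blast
qed simp

lemma less_mult_add: "i * p + a < q * p" if "i < q" "a < p" for i p a q :: nat
proof -
  have "i * p + a < Suc i * p" using that by simp
  also have "\<dots> \<le> q * p" using that by (intro mult_le_mono1) simp
  finally show ?thesis .
qed

lemma sum_swap3:
  "(\<Sum>a\<in>A. \<Sum>b\<in>B. \<Sum>k\<in>I. f a b k) = (\<Sum>k\<in>I. \<Sum>a\<in>A. \<Sum>b\<in>B. f a b k)"
proof -
  have "(\<Sum>a\<in>A. \<Sum>b\<in>B. \<Sum>k\<in>I. f a b k) = (\<Sum>a\<in>A. \<Sum>k\<in>I. \<Sum>b\<in>B. f a b k)"
    by (rule sum.cong[OF refl], rule sum.swap)
  then show ?thesis by (simp only: sum.swap[of _ I A])
qed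

lemma index_mult_adjoint:
  assumes "A \<in> carrier_mat n m" "X \<in> carrier_mat m l" "B \<in> carrier_mat k l" "i < n" "j < k"
  shows "(A * X * mat_adjoint B) $$ (i, j) = (\<Sum>a<m. \<Sum>b<l. A $$ (i, a) * X $$ (a, b) * cnj (B $$ (j, b)))"
proof -
  have "(A * X * mat_adjoint B) $$ (i, j) = (\<Sum>b<l. (A * X) $$ (i, b) * mat_adjoint B $$ (b, j))"
    by (rule index_mult_mat_sum) (use assms in auto)
  also have "\<dots> = (\<Sum>b<l. \<Sum>a<m. A $$ (i, a) * X $$ (a, b) * cnj (B $$ (j, b)))"
  proof (intro sum.cong refl)
    fix b assume "b \<in> {..<l}"
    then have b: "b < l" by simp
    show "(A * X) $$ (i, b) * mat_adjoint B $$ (b, j) =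
        (\<Sum>a<m. A $$ (i, a) * X $$ (a, b) * cnj (B $$ (j, b)))"
      unfolding index_mult_mat_sum[OF assms(1,2,4) b] sum_distrib_right
      using assms b by (intro sum.cong refl) simp
  qed
  finally show ?thesis by (subst sum.swap)
qed

lemma psd_iff_hform:
  "psd n A \<longleftrightarrow> A \<in> carrier_mat n n \<and> (\<forall>x. 0 \<le> hform (\<lambda>i j. A $$ (i, j)) n x)"
proof -
  have eq: "(A *\<^sub>v v) \<bullet>c v = hform (\<lambda>i j. A $$ (i, j)) n (($) v)"
    if "A \<in> carrier_mat n n" "v \<in> carrier_vec n" for v
    using that by (auto simp: scalar_prod_def lessThan_atLeast0 sum_distrib_left sum_distrib_right
        mult_ac intro!: sum.cong)
  have cong: "hform (\<lambda>i j. A $$ (i, j)) n (($) (vec n x)) = hform (\<lambda>i j. A $$ (i, j)) n x" for x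
    by (intro sum.cong refl) simp
  show ?thesis
  proof
    assume psd: "psd n A"
    then have A: "A \<in> carrier_mat n n" by (simp add: psd_def)
    have "0 \<le> hform (\<lambda>i j. A $$ (i, j)) n x" for x
    proof -
      have "0 \<le> (A *\<^sub>v vec n x) \<bullet>c vec n x" using psd by (simp add: psd_def)
      then show ?thesis by (simp only: eq[OF A vec_carrier] cong)
    qed
    with A show "A \<in> carrier_mat n n \<and> (\<forall>x. 0 \<le> hform (\<lambda>i j. A $$ (i, j)) n x)" by blast
  qed (auto simp: psd_def eq)
qed

lemma psd_adjoint:
  assumes "psd n A" shows "mat_adjoint A = A"
proof (rule eq_matI)
  have A: "A \<in> carrier_mat n n" and pos: "\<And>x. 0 \<le> hform (\<lambda>i j. A $$ (i, j)) n x"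
    using assms by (auto simp: psd_iff_hform)
  fix i j assume "i < dim_row A" "j < dim_col A"
  then show "mat_adjoint A $$ (i, j) = A $$ (i, j)"
    using hform_nonneg_imp_hermitian[OF pos, of j i] A by simp
qed (use assms in \<open>auto simp: psd_def\<close>)

text \<open>The form at \<open>x\<close> is the sum over \<open>k\<close> of the squared moduli of
  the inner products of \<open>w k\<close> with \<open>x\<close>.\<close>

lemma psd_outer_sum:
  assumes "A \<in> carrier_mat n n"
    and A: "\<And>i j. i < n \<Longrightarrow> j < n \<Longrightarrow> A $$ (i, j) = (\<Sum>k\<in>I. w k i * cnj (w k j))"
  shows "psd n A"
  unfolding psd_iff_hform
proof (intro conjI allI)
  fix x
  let ?z = "\<lambda>k. \<Sum>j<n. cnj (w k j) * x j"
  have "hform (\<lambda>i j. A $$ (i, j)) n x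
      = (\<Sum>i<n. \<Sum>j<n. \<Sum>k\<in>I. cnj (x i) * w k i * (cnj (w k j) * x j))"
    by (intro sum.cong refl) (simp add: A sum_distrib_left sum_distrib_right mult_ac)
  also have "\<dots> = (\<Sum>k\<in>I. \<Sum>i<n. \<Sum>j<n. cnj (x i) * w k i * (cnj (w k j) * x j))"
    by (rule sum_swap3)
  also have "\<dots> = (\<Sum>k\<in>I. (\<Sum>i<n. cnj (x i) * w k i) * ?z k)"
    by (simp only: sum_product)
  also have "\<dots> = (\<Sum>k\<in>I. cnj (?z k) * ?z k)"
    by (simp add: mult.commute)
  also have "\<dots> = of_real (\<Sum>k\<in>I. (cmod (?z k))\<^sup>2)"
    unfolding of_real_sum complex_norm_square by (intro sum.cong refl mult.commute)
  also have "0 \<le> \<dots>" by (simp add: less_eq_complex_def sum_nonneg)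
  finally show "0 \<le> hform (\<lambda>i j. A $$ (i, j)) n x" .
qed fact

subsection \<open>Kraus representations\<close>

lemma linear_op_msum:
  assumes E: "linear_op p q E" and "finite I" "\<And>k. k \<in> I \<Longrightarrow> f k \<in> carrier_mat p p"
  shows "E (msum p p f I) = msum q q (\<lambda>k. E (f k)) I"
  using assms(2,3)
proof (induction I)
  case empty
  \<comment> \<open>Additivity and homogeneity are the only linearity clauses, so
    \<open>E 0 = 0\<close> comes from homogeneity with the scalar 0.\<close>
  have "E (0 \<cdot>\<^sub>m 0\<^sub>m p p) = 0 \<cdot>\<^sub>m E (0\<^sub>m p p)" "E (0\<^sub>m p p) \<in> carrier_mat q q"
    using E zero_carrier_mat unfolding linear_op_def by blast+
  moreover have "0 \<cdot>\<^sub>m 0\<^sub>m p p = (0\<^sub>m p p :: complex mat)" by (rule eq_matI) auto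
  moreover have "0 \<cdot>\<^sub>m X = 0\<^sub>m q q" if "X \<in> carrier_mat q q" for X :: "complex mat"
    by (rule eq_matI) (use that in auto)
  ultimately show ?case by simp
next
  case (insert k I)
  then have "E (msum p p f (insert k I)) = E (f k + msum p p f I)"
    by (subst msum_insert) auto
  also have "\<dots> = E (f k) + msum q q (\<lambda>k. E (f k)) I"
    using E insert by (simp add: linear_op_def)
  also have "\<dots> = msum q q (\<lambda>k. E (f k)) (insert k I)"
    by (rule msum_insert[symmetric]) (use E insert in \<open>auto simp: linear_op_def\<close>)
  finally show ?case .
qed

definition unit_mat :: "nat \<Rightarrow> nat \<Rightarrow> nat \<Rightarrow> complex mat" where
  "unit_mat n a b = mat n n (\<lambda>ij. if ij = (a, b) then 1 else 0)"

lemma unit_mat_carrier [simp, intro]: "unit_mat n a b \<in> carrier_mat n n"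
  by (simp add: unit_mat_def)

lemma linear_op_expand:
  assumes E: "linear_op p q E" and X: "X \<in> carrier_mat p p" and ij: "i < q" "j < q"
  shows "E X $$ (i, j) = (\<Sum>a<p. \<Sum>b<p. X $$ (a, b) * E (unit_mat p a b) $$ (i, j))"
proof -
  let ?I = "{..<p} \<times> {..<p}"
  have "X = msum p p (\<lambda>ab. X $$ ab \<cdot>\<^sub>m unit_mat p (fst ab) (snd ab)) ?I" (is "_ = ?R")
  proof (rule eq_matI)
    fix a b assume "a < dim_row ?R" "b < dim_col ?R"
    then have ab: "a < p" "b < p" by auto
    have "?R $$ (a, b) = (\<Sum>cd\<in>?I. X $$ cd * (if (a, b) = cd then 1 else 0))"
      using ab by (simp add: unit_mat_def)
    also have "\<dots> = X $$ (a, b)"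
      using ab by (simp add: if_distrib[of "\<lambda>x. _ * x"] cong: if_cong)
    finally show "X $$ (a, b) = ?R $$ (a, b)" ..
  qed (use X in auto)
  then have "E X = E ?R" by (rule arg_cong)
  also have "\<dots> = msum q q (\<lambda>ab. E (X $$ ab \<cdot>\<^sub>m unit_mat p (fst ab) (snd ab))) ?I"
    by (rule linear_op_msum[OF E]) auto
  also have "\<dots> = msum q q (\<lambda>ab. X $$ ab \<cdot>\<^sub>m E (unit_mat p (fst ab) (snd ab))) ?I"
    using E by (intro msum_cong) (auto simp: linear_op_def)
  also have "\<dots> $$ (i, j) = (\<Sum>ab\<in>?I. X $$ ab * E (unit_mat p (fst ab) (snd ab)) $$ (i, j))"
    using ij E by (auto simp: linear_op_def intro!: sum.cong index_smult_mat(1))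
  finally show ?thesis by (simp add: sum.cartesian_product case_prod_beta)
qed

text \<open>The last conjunct is the Kraus form of trace preservation.\<close>

definition kraus_rep ::
  "nat \<Rightarrow> nat \<Rightarrow> nat \<Rightarrow> (nat \<Rightarrow> complex mat) \<Rightarrow> (complex mat \<Rightarrow> complex mat) \<Rightarrow> bool" where
  "kraus_rep p q K A E \<longleftrightarrow>
     (\<forall>k<K. A k \<in> carrier_mat q p) \<and>
     (\<forall>X\<in>carrier_mat p p. E X = msum q q (\<lambda>k. A k * X * mat_adjoint (A k)) {..<K}) \<and>
     msum p p (\<lambda>k. mat_adjoint (A k) * A k) {..<K} = 1\<^sub>m p"

text \<open>Choi's theorem. Complete positivity makes the Choi matrix positive semidefinite, hence a
  sum of outer products of vectors of length \<open>q * p\<close>; each vector, reshaped into a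
  \<open>q\<close> by \<open>p\<close> matrix, is a Kraus operator.\<close>

lemma cptp_imp_kraus_rep:
  assumes "cptp p q E"
  shows "\<exists>K A. kraus_rep p q K A E"
proof -
  have lin: "linear_op p q E" and cp: "completely_positive p q E" and tp: "trace_preserving p E"
    using assms by (auto simp: cptp_def)
  \<comment> \<open>The outer product of the unnormalized maximally entangled vector, the sum over
    \<open>a\<close> of \<open>e_a \<otimes> e_a\<close>, with itself.\<close>
  define \<Omega> :: "complex mat" where
    "\<Omega> = mat (p * p) (p * p) (\<lambda>(r, s). if r div p = r mod p \<and> s div p = s mod p then 1 else 0)"
  define C where "C = tensor_id p q p E \<Omega>"
  have "psd (p * p) \<Omega>"
    by (rule psd_outer_sum[where I = "{()}" and w = "\<lambda>_ r. if r div p = r mod p then 1 else 0"])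
      (auto simp: \<Omega>_def)
  then have "psd (q * p) C" using cp by (simp add: completely_positive_def C_def)
  then have "\<And>x. 0 \<le> hform (\<lambda>i j. C $$ (i, j)) (q * p) x" by (simp add: psd_iff_hform)
  from hform_nonneg_imp_factor[OF this] obtain v where
    v: "\<And>r s. r < q * p \<Longrightarrow> s < q * p \<Longrightarrow> C $$ (r, s) = (\<Sum>k<q*p. v k r * cnj (v k s))"
    by blast
  \<comment> \<open>The Choi matrix records the values of \<open>E\<close> on all matrix units, and
    these determine \<open>E\<close> by linearity.\<close>
  have C: "C $$ (i * p + a, j * p + b) = E (unit_mat p a b) $$ (i, j)"
    if "i < q" "j < q" "a < p" "b < p" for i j a b
  proof -
    have "mat p p (\<lambda>(a', b'). \<Omega> $$ (a' * p + a, b' * p + b)) = unit_mat p a b"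
      by (rule eq_matI) (use that in \<open>auto simp: \<Omega>_def unit_mat_def less_mult_add\<close>)
    then show ?thesis using that by (simp add: C_def tensor_id_def less_mult_add)
  qed
  define A where "A k = mat q p (\<lambda>(i, a). v k (i * p + a))" for k
  have A: "A k \<in> carrier_mat q p" for k by (simp add: A_def)
  have EA: "E (unit_mat p a b) $$ (i, j) = (\<Sum>k<q*p. A k $$ (i, a) * cnj (A k $$ (j, b)))"
    if "i < q" "j < q" "a < p" "b < p" for i j a b
    using that C[OF that] v by (simp add: less_mult_add A_def)
  have "E X = msum q q (\<lambda>k. A k * X * mat_adjoint (A k)) {..<q*p}" (is "_ = ?R")
    if X: "X \<in> carrier_mat p p" for X
  proof (rule eq_matI)
    fix i j assume "i < dim_row ?R" "j < dim_col ?R"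
    then have ij: "i < q" "j < q" by auto
    have "E X $$ (i, j) = (\<Sum>a<p. \<Sum>b<p. \<Sum>k<q*p. A k $$ (i, a) * X $$ (a, b) * cnj (A k $$ (j, b)))"
      unfolding linear_op_expand[OF lin X ij]
      by (intro sum.cong refl) (simp add: EA ij sum_distrib_left mult_ac)
    also have "\<dots> = (\<Sum>k<q*p. \<Sum>a<p. \<Sum>b<p. A k $$ (i, a) * X $$ (a, b) * cnj (A k $$ (j, b)))"
      by (rule sum_swap3)
    also have "\<dots> = ?R $$ (i, j)"
      using ij by (simp add: index_mult_adjoint[OF A X A] del: index_mult_mat)
    finally show "E X $$ (i, j) = ?R $$ (i, j)" .
  qed (use lin X in \<open>auto simp: linear_op_def\<close>)
  \<comment> \<open>Entry \<open>(b, a)\<close> of the sum is the trace of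
    \<open>E (unit_mat p a b)\<close>, with the indices exchanged; trace preservation turns it into
    the trace of a matrix unit.\<close>
  moreover have "msum p p (\<lambda>k. mat_adjoint (A k) * A k) {..<q*p} = 1\<^sub>m p" (is "?L = _")
  proof (rule eq_matI)
    fix b a assume "b < dim_row (1\<^sub>m p :: complex mat)" "a < dim_col (1\<^sub>m p :: complex mat)"
    then have ab: "b < p" "a < p" by auto
    have dim: "dim_row (E (unit_mat p a b)) = q" using lin by (auto simp: linear_op_def)
    have "?L $$ (b, a) = (\<Sum>k<q*p. \<Sum>i<q. cnj (A k $$ (i, b)) * A k $$ (i, a))"
      using ab A[THEN carrier_matD(1)] A[THEN carrier_matD(2)]
      by (simp add: index_mult_mat_sum[OF mat_adjoint_carrier[OF A] A] del: index_mult_mat)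
    also have "\<dots> = (\<Sum>i<q. \<Sum>k<q*p. cnj (A k $$ (i, b)) * A k $$ (i, a))"
      by (rule sum.swap)
    also have "\<dots> = mtrace (E (unit_mat p a b))"
      unfolding mtrace_def dim by (intro sum.cong refl) (simp add: EA ab mult.commute)
    also have "\<dots> = mtrace (unit_mat p a b)"
      using tp by (auto simp: trace_preserving_def)
    also have "\<dots> = 1\<^sub>m p $$ (b, a)"
      using ab by (auto simp: mtrace_def unit_mat_def intro: sum.neutral)
    finally show "?L $$ (b, a) = 1\<^sub>m p $$ (b, a)" .
  qed auto
  ultimately show ?thesis using A unfolding kraus_rep_def by blast
qed

section \<open>Kraus operators of the identity channel\<close>

lemma sum_mult_cnj_eq_0:
  assumes "finite I" "(\<Sum>k\<in>I. z k * cnj (z k)) = 0" "k \<in> I"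
  shows "z k = 0"
proof -
  have "complex_of_real (\<Sum>k\<in>I. (cmod (z k))\<^sup>2) = 0"
    unfolding of_real_sum complex_norm_square using assms(2) .
  then have "(\<Sum>k\<in>I. (cmod (z k))\<^sup>2) = 0" by (simp only: of_real_eq_0_iff)
  then show ?thesis using assms by (simp add: sum_nonneg_eq_0_iff)
qed

lemma density_matrix_pure:
  assumes "(\<Sum>a<p. x a * cnj (x a)) = 1"
  shows "density_matrix p (mat p p (\<lambda>(a, b). x a * cnj (x b)))"
  using assms
  by (auto simp: density_matrix_def mtrace_def intro!: psd_outer_sum[where I = "{()}" and w = "\<lambda>_. x"])

text \<open>Pure states suffice as tests. Basis states force every \<open>M k\<close> to be
  diagonal; superpositions of two basis states show that the diagonals at \<open>a\<close> and
  \<open>b\<close>, as vectors indexed by \<open>k\<close>, have inner product 1. Since both have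
  norm 1, they coincide.\<close>

lemma kraus_identity_scalar:
  assumes fin: "finite I" and M: "\<And>k. k \<in> I \<Longrightarrow> M k \<in> carrier_mat p p"
    and id: "\<And>\<rho>. density_matrix p \<rho> \<Longrightarrow> msum p p (\<lambda>k. M k * \<rho> * mat_adjoint (M k)) I = \<rho>"
    and k: "k \<in> I"
  shows "\<exists>c. M k = c \<cdot>\<^sub>m 1\<^sub>m p"
proof -
  have key: "(\<Sum>k\<in>I. (\<Sum>e<p. M k $$ (c, e) * x e) * cnj (\<Sum>e<p. M k $$ (d, e) * x e)) = x c * cnj (x d)"
    if x: "(\<Sum>a<p. x a * cnj (x a)) = 1" and cd: "c < p" "d < p" for x c d
  proof -
    let ?\<rho> = "mat p p (\<lambda>(a, b). x a * cnj (x b))"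
    have "x c * cnj (x d) = msum p p (\<lambda>k. M k * ?\<rho> * mat_adjoint (M k)) I $$ (c, d)"
      using cd by (simp add: id[OF density_matrix_pure[OF x]])
    also have "\<dots> = (\<Sum>k\<in>I. (M k * ?\<rho> * mat_adjoint (M k)) $$ (c, d))"
      using cd by (rule index_msum)
    also have "\<dots> = (\<Sum>k\<in>I. (\<Sum>e<p. M k $$ (c, e) * x e) * cnj (\<Sum>e<p. M k $$ (d, e) * x e))"
    proof (rule sum.cong[OF refl])
      fix k assume "k \<in> I"
      note Mk = M[OF this]
      show "(M k * ?\<rho> * mat_adjoint (M k)) $$ (c, d)
          = (\<Sum>e<p. M k $$ (c, e) * x e) * cnj (\<Sum>e<p. M k $$ (d, e) * x e)"
        unfolding index_mult_adjoint[OF Mk mat_carrier Mk cd] cnj_sum sum_product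
        by (intro sum.cong refl) simp
    qed
    finally show ?thesis ..
  qed
  have basis: "(\<Sum>k\<in>I. M k $$ (c, a) * cnj (M k $$ (d, a))) = (if c = a \<and> d = a then 1 else 0)"
    if "a < p" "c < p" "d < p" for a c d
    using key[of "\<lambda>e. if e = a then 1 else 0" c d] that
    by (simp add: if_distrib[of cnj] if_distrib[of "\<lambda>x. _ * x"] cong: if_cong)
  have off: "M k $$ (c, a) = 0" if "k \<in> I" "a < p" "c < p" "c \<noteq> a" for k a c
    by (rule sum_mult_cnj_eq_0[OF fin _ that(1)]) (use basis[of a c c] that in simp)
  have cross: "(\<Sum>k\<in>I. M k $$ (a, a) * cnj (M k $$ (b, b))) = 1" if ab: "a < p" "b < p" for a b
  proof (cases "a = b")
    case False
    \<comment> \<open>Amplitude of the superposition of \<open>e_a\<close> and \<open>e_b\<close>.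
      Its density matrix has a nonzero entry at \<open>(a, b)\<close>, and preserving that entry
      gives the claim.\<close>
    define s where "s = complex_of_real (1 / sqrt 2)"
    have s: "s * cnj s = 1 / 2" by (simp add: s_def flip: of_real_mult)
    define x where "x e = (if e = a then s else 0) + (if e = b then s else 0)" for e
    have ss: "x e * cnj (x e) = (if e = a then 1 / 2 else 0) + (if e = b then 1 / 2 else 0)" for e
      using False s by (auto simp: x_def)
    have x1: "(\<Sum>a<p. x a * cnj (x a)) = 1"
      unfolding ss sum.distrib using ab by simp
    have Mx: "(\<Sum>e<p. M k $$ (c, e) * x e) = M k $$ (c, c) * s" if "k \<in> I" "c \<in> {a, b}" for k c
      using that ab False off[OF that(1), of a b] off[OF that(1), of b a]
      by (auto simp: x_def algebra_simps sum.distrib if_distrib[of "\<lambda>x. x * _"] cong: if_cong)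
    have "(\<Sum>k\<in>I. (M k $$ (a, a) * s) * cnj (M k $$ (b, b) * s)) = x a * cnj (x b)"
      unfolding key[OF x1 ab, symmetric] by (intro sum.cong refl) (simp only: Mx insertI1 insertI2)
    also have "x a * cnj (x b) = s * cnj s" using False by (simp add: x_def)
    also have "(\<Sum>k\<in>I. (M k $$ (a, a) * s) * cnj (M k $$ (b, b) * s))
        = (\<Sum>k\<in>I. M k $$ (a, a) * cnj (M k $$ (b, b))) * (s * cnj s)"
      unfolding sum_distrib_right by (intro sum.cong refl) simp
    finally show ?thesis unfolding s by simp
  qed (use basis[of a a a] ab in simp)
  have eq: "M k $$ (a, a) = M k $$ (b, b)" if ab: "a < p" "b < p" for a b
  proof -
    have "(\<Sum>k\<in>I. (M k $$ (a, a) - M k $$ (b, b)) * cnj (M k $$ (a, a) - M k $$ (b, b))) = 0"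
      using cross[of a a] cross[of a b] cross[of b a] cross[of b b] ab
      by (simp add: algebra_simps sum.distrib sum_subtractf)
    from sum_mult_cnj_eq_0[OF fin this k] show ?thesis by simp
  qed
  \<comment> \<open>For \<open>p = 0\<close> the entry \<open>(0, 0)\<close> lies outside the
    matrix, but then both sides have no entries.\<close>
  have "M k = M k $$ (0, 0) \<cdot>\<^sub>m 1\<^sub>m p"
  proof (rule eq_matI)
    fix i j assume "i < dim_row (M k $$ (0, 0) \<cdot>\<^sub>m 1\<^sub>m p)" "j < dim_col (M k $$ (0, 0) \<cdot>\<^sub>m 1\<^sub>m p)"
    then show "M k $$ (i, j) = (M k $$ (0, 0) \<cdot>\<^sub>m 1\<^sub>m p) $$ (i, j)"
      using off[OF k, of j i] eq[of i 0] by (cases "i = j") auto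
  qed (use M[OF k] in auto)
  then show ?thesis ..
qed

text \<open>Composing the two Kraus sums gives a sum over pairs \<open>(l, k)\<close> with operators
  \<open>B l * A k\<close>. It fixes every density matrix, so each of these operators is a
  scalar.\<close>

lemma kraus_left_inverse_scalar:
  assumes E: "kraus_rep p q K A E" and D: "kraus_rep q p L B D"
    and inverse: "\<And>\<rho>. density_matrix p \<rho> \<Longrightarrow> D (E \<rho>) = \<rho>"
    and kl: "k < K" "l < L"
  shows "\<exists>c. B l * A k = c \<cdot>\<^sub>m 1\<^sub>m p"
proof -
  have A: "k < K \<Longrightarrow> A k \<in> carrier_mat q p" and B: "l < L \<Longrightarrow> B l \<in> carrier_mat p q" for k l
    using E D by (auto simp: kraus_rep_def)
  let ?M = "\<lambda>lk. B (fst lk) * A (snd lk)"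
  let ?I = "{..<L} \<times> {..<K}"
  have "msum p p (\<lambda>lk. ?M lk * \<rho> * mat_adjoint (?M lk)) ?I = \<rho>" if \<rho>: "density_matrix p \<rho>" for \<rho>
  proof -
    have R: "\<rho> \<in> carrier_mat p p" using \<rho> by (auto simp: density_matrix_def psd_def)
    have ARA: "A k * \<rho> * mat_adjoint (A k) \<in> carrier_mat q q" if "k < K" for k
      using A[OF that] R by auto
    have step: "B l * (A k * \<rho> * mat_adjoint (A k)) * mat_adjoint (B l)
        = B l * A k * \<rho> * mat_adjoint (B l * A k)" if "k < K" "l < L" for k l
    proof -
      note c = A[OF that(1)] B[OF that(2)] R
      have "B l * A k * \<rho> * mat_adjoint (B l * A k)
          = B l * A k * \<rho> * (mat_adjoint (A k) * mat_adjoint (B l))"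
        using mat_adjoint_mult[OF c(2,1)] by simp
      also have "\<dots> = B l * A k * \<rho> * mat_adjoint (A k) * mat_adjoint (B l)"
        by (rule assoc_mult_mat[symmetric, of _ p p _ q _ p]) (use c in auto)
      also have "B l * A k * \<rho> * mat_adjoint (A k) = B l * (A k * \<rho> * mat_adjoint (A k))"
        using c by (simp add: assoc_mult_mat[of _ p q _ p _ p] assoc_mult_mat[of _ p q _ p _ q]
            assoc_mult_mat[of _ p p _ p _ q] assoc_mult_mat[of _ q p _ p _ q] mult_carrier_mat[of _ q p])
      finally show ?thesis ..
    qed
    have "\<rho> = D (E \<rho>)" using inverse[OF \<rho>] ..
    also have "\<dots> = msum p p (\<lambda>l. B l * E \<rho> * mat_adjoint (B l)) {..<L}"
      using D E R by (auto simp: kraus_rep_def)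
    also have "\<dots> = msum p p (\<lambda>l. msum p p (\<lambda>k. B l * A k * \<rho> * mat_adjoint (B l * A k)) {..<K}) {..<L}"
    proof (rule msum_cong)
      fix l assume "l \<in> {..<L}"
      then have l: "l < L" by simp
      have "B l * E \<rho> * mat_adjoint (B l)
          = B l * msum q q (\<lambda>k. A k * \<rho> * mat_adjoint (A k)) {..<K} * mat_adjoint (B l)"
        using E R by (simp add: kraus_rep_def)
      also have "\<dots> = msum p q (\<lambda>k. B l * (A k * \<rho> * mat_adjoint (A k))) {..<K} * mat_adjoint (B l)"
        using ARA by (subst mult_msum[OF B[OF l]]) auto
      also have "\<dots> = msum p p (\<lambda>k. B l * (A k * \<rho> * mat_adjoint (A k)) * mat_adjoint (B l)) {..<K}"
        by (rule msum_mult) (use ARA B[OF l] in auto)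
      also have "\<dots> = msum p p (\<lambda>k. B l * A k * \<rho> * mat_adjoint (B l * A k)) {..<K}"
        by (rule msum_cong) (use step l in simp)
      finally show "B l * E \<rho> * mat_adjoint (B l) = \<dots>" .
    qed
    also have "\<dots> = msum p p (\<lambda>lk. ?M lk * \<rho> * mat_adjoint (?M lk)) ?I"
      by (rule eq_matI) (auto simp: sum.cartesian_product case_prod_beta simp del: index_mult_mat)
    finally show ?thesis ..
  qed
  moreover have "?M lk \<in> carrier_mat p p" if "lk \<in> ?I" for lk
    using that A B by (intro mult_carrier_mat[of _ p q]) auto
  ultimately show ?thesis
    using kraus_identity_scalar[where M = ?M and I = ?I and k = "(l, k)"] kl by simp
qed

subsection \<open>Correctable operators\<close>

text \<open>If the \<open>B l\<close> are Kraus operators of a channel \<open>D\<close>, these are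
  the errors that \<open>D\<close> undoes: \<open>D\<close> sends
  \<open>X * \<rho> * mat_adjoint X\<close> to a nonnegative multiple of \<rho>.\<close>

definition correctable ::
  "nat \<Rightarrow> nat \<Rightarrow> nat \<Rightarrow> (nat \<Rightarrow> complex mat) \<Rightarrow> complex mat set" where
  "correctable p q L B = {X \<in> carrier_mat q p. \<forall>l<L. \<exists>c. B l * X = c \<cdot>\<^sub>m 1\<^sub>m p}"

lemma correctable_add:
  assumes "\<And>l. l < L \<Longrightarrow> B l \<in> carrier_mat p q" "X \<in> correctable p q L B" "Y \<in> correctable p q L B"
  shows "X + Y \<in> correctable p q L B"
  unfolding correctable_def
proof (intro CollectI conjI allI impI)
  fix l assume l: "l < L"
  have XY: "X \<in> carrier_mat q p" "Y \<in> carrier_mat q p" using assms by (auto simp: correctable_def)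
  obtain c d where "B l * X = c \<cdot>\<^sub>m 1\<^sub>m p" "B l * Y = d \<cdot>\<^sub>m 1\<^sub>m p"
    using assms l unfolding correctable_def by blast
  then have "B l * (X + Y) = (c + d) \<cdot>\<^sub>m 1\<^sub>m p"
    by (simp add: mult_add_distrib_mat[OF assms(1)[OF l] XY] add_smult_distrib_right_mat[of _ p p])
  then show "\<exists>c. B l * (X + Y) = c \<cdot>\<^sub>m 1\<^sub>m p" ..
qed (use assms in \<open>auto simp: correctable_def\<close>)

lemma correctable_smult:
  assumes "\<And>l. l < L \<Longrightarrow> B l \<in> carrier_mat p q" "X \<in> correctable p q L B"
  shows "c \<cdot>\<^sub>m X \<in> correctable p q L B"
  unfolding correctable_def
proof (intro CollectI conjI allI impI)
  fix l assume l: "l < L"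
  have X: "X \<in> carrier_mat q p" using assms by (auto simp: correctable_def)
  obtain d where "B l * X = d \<cdot>\<^sub>m 1\<^sub>m p"
    using assms l unfolding correctable_def by blast
  then have "B l * (c \<cdot>\<^sub>m X) = (c * d) \<cdot>\<^sub>m 1\<^sub>m p"
    by (simp add: mult_smult_distrib[OF assms(1)[OF l] X] smult_smult_mat)
  then show "\<exists>d. B l * (c \<cdot>\<^sub>m X) = d \<cdot>\<^sub>m 1\<^sub>m p" ..
qed (use assms in \<open>auto simp: correctable_def\<close>)

text \<open>Insert \<open>\<Sum>\<^sub>l B\<^sub>l\<^sup>\<dagger> B\<^sub>l = 1\<close> between the
  two factors; the term for \<open>l\<close> becomes the adjoint of \<open>B l * X\<close> times
  \<open>B l * Y\<close>. This is the Knill-Laflamme condition, and the scalar serves as an inner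
  product on correctable operators.\<close>

lemma correctable_inner:
  assumes D: "kraus_rep q p L B D" and X: "X \<in> carrier_mat q p" and Y: "Y \<in> carrier_mat q p"
    and c: "\<And>l. l < L \<Longrightarrow> B l * X = c l \<cdot>\<^sub>m 1\<^sub>m p" and d: "\<And>l. l < L \<Longrightarrow> B l * Y = d l \<cdot>\<^sub>m 1\<^sub>m p"
  shows "mat_adjoint X * Y = (\<Sum>l<L. cnj (c l) * d l) \<cdot>\<^sub>m 1\<^sub>m p"
proof -
  have B: "B l \<in> carrier_mat p q" if "l < L" for l using D that by (auto simp: kraus_rep_def)
  have BB: "mat_adjoint (B l) * B l \<in> carrier_mat q q" if "l < L" for l using B[OF that] by auto
  have X': "mat_adjoint X \<in> carrier_mat p q" using X by auto
  have "mat_adjoint X * Y = mat_adjoint X * 1\<^sub>m q * Y"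
    using X by simp
  also have "\<dots> = mat_adjoint X * msum q q (\<lambda>l. mat_adjoint (B l) * B l) {..<L} * Y"
    using D by (simp add: kraus_rep_def)
  also have "\<dots> = msum p q (\<lambda>l. mat_adjoint X * (mat_adjoint (B l) * B l)) {..<L} * Y"
    by (subst mult_msum[OF X']) (use BB in auto)
  also have "\<dots> = msum p p (\<lambda>l. mat_adjoint X * (mat_adjoint (B l) * B l) * Y) {..<L}"
    by (rule msum_mult[OF Y]) (use BB X' in auto)
  also have "\<dots> = msum p p (\<lambda>l. (cnj (c l) * d l) \<cdot>\<^sub>m 1\<^sub>m p) {..<L}"
  proof (rule msum_cong)
    fix l assume "l \<in> {..<L}"
    then have l: "l < L" by simp
    note Bl = B[OF l]
    have "mat_adjoint X * (mat_adjoint (B l) * B l) * Y = mat_adjoint X * mat_adjoint (B l) * B l * Y"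
      using assoc_mult_mat[of "mat_adjoint X" p q "mat_adjoint (B l)" p "B l" q] X' Bl by auto
    also have "\<dots> = mat_adjoint X * mat_adjoint (B l) * (B l * Y)"
      by (rule assoc_mult_mat[of _ p p _ q _ p]) (use X' Bl Y in auto)
    also have "mat_adjoint X * mat_adjoint (B l) = mat_adjoint (B l * X)"
      using mat_adjoint_mult[OF Bl X] ..
    also have "mat_adjoint (B l * X) * (B l * Y) = (cnj (c l) * d l) \<cdot>\<^sub>m 1\<^sub>m p"
      unfolding c[OF l] d[OF l] mat_adjoint_smult
      by (simp add: mult_smult_assoc_mat[of _ p p _ p] mult_smult_distrib[of _ p p _ p] smult_smult_mat
          mult.commute)
    finally show "mat_adjoint X * (mat_adjoint (B l) * B l) * Y = (cnj (c l) * d l) \<cdot>\<^sub>m 1\<^sub>m p" .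
  qed
  also have "\<dots> = (\<Sum>l<L. cnj (c l) * d l) \<cdot>\<^sub>m 1\<^sub>m p"
    by (rule msum_smult_const) auto
  finally show ?thesis .
qed

section \<open>Orthonormal families of operators and Gram-Schmidt\<close>

lemma add_msum_closed:
  assumes add: "\<And>X Y. X \<in> S \<Longrightarrow> Y \<in> S \<Longrightarrow> X + Y \<in> S"
    and smult: "\<And>c X. X \<in> S \<Longrightarrow> c \<cdot>\<^sub>m X \<in> S" and S: "S \<subseteq> carrier_mat q p"
    and X: "X \<in> S" and "finite I" "\<And>i. i \<in> I \<Longrightarrow> W i \<in> S"
  shows "X + msum q p (\<lambda>i. c i \<cdot>\<^sub>m W i) I \<in> S"
  using assms(5,6)
proof (induction I)
  case empty
  have "X + 0\<^sub>m q p = X" using X S by (intro right_add_zero_mat) auto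
  then show ?case using X by simp
next
  case (insert i I)
  let ?R = "msum q p (\<lambda>i. c i \<cdot>\<^sub>m W i) I"
  have W: "c i \<cdot>\<^sub>m W i \<in> S" using insert smult by simp
  have "msum q p (\<lambda>i. c i \<cdot>\<^sub>m W i) (insert i I) = c i \<cdot>\<^sub>m W i + ?R"
    by (rule msum_insert) (use insert W S in auto)
  then have "X + msum q p (\<lambda>i. c i \<cdot>\<^sub>m W i) (insert i I) = X + (c i \<cdot>\<^sub>m W i + ?R)" by simp
  also have "\<dots> = c i \<cdot>\<^sub>m W i + (X + ?R)"
    using X W S by (intro eq_matI) auto
  finally show ?case using add[OF W] insert by auto
qed

lemma adjoint_mult_self_diag:
  fixes X :: "complex mat"
  assumes "X \<in> carrier_mat q p" "a < p"
  shows "(mat_adjoint X * X) $$ (a, a) = of_real (\<Sum>x<q. (cmod (X $$ (x, a)))\<^sup>2)"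
proof -
  have "(mat_adjoint X * X) $$ (a, a) = (\<Sum>x<q. X $$ (x, a) * cnj (X $$ (x, a)))"
    unfolding index_mult_mat_sum[OF mat_adjoint_carrier[OF assms(1)] assms(1,2,2)]
    by (intro sum.cong refl) (use assms in auto)
  then show ?thesis unfolding of_real_sum complex_norm_square .
qed

lemma adjoint_mult_self_eq_0:
  fixes X :: "complex mat"
  assumes X: "X \<in> carrier_mat q p" and 0: "mat_adjoint X * X = 0\<^sub>m p p"
  shows "X = 0\<^sub>m q p"
proof (rule eq_matI)
  fix x a assume "x < dim_row (0\<^sub>m q p :: complex mat)" "a < dim_col (0\<^sub>m q p :: complex mat)"
  then have xa: "x < q" "a < p" by auto
  have "complex_of_real (\<Sum>x<q. (cmod (X $$ (x, a)))\<^sup>2) = 0"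
    using adjoint_mult_self_diag[OF X xa(2)] xa(2) unfolding 0 by simp
  then have "(\<Sum>x<q. (cmod (X $$ (x, a)))\<^sup>2) = 0" by (simp only: of_real_eq_0_iff)
  then show "X $$ (x, a) = 0\<^sub>m q p $$ (x, a)" using xa by (simp add: sum_nonneg_eq_0_iff)
qed (use X in auto)

text \<open>The equations with \<open>i = j\<close> make each \<open>W i\<close> an isometry; those
  with distinct indices make the ranges orthogonal.\<close>

definition orthonormal_ops :: "nat \<Rightarrow> nat \<Rightarrow> (nat \<Rightarrow> complex mat) \<Rightarrow> bool" where
  "orthonormal_ops p r W \<longleftrightarrow>
     (\<forall>i<r. \<forall>j<r. mat_adjoint (W i) * W j = (if i = j then 1\<^sub>m p else 0\<^sub>m p p))"

lemma adjoint_mult_msum: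
  assumes "\<And>i. i < r \<Longrightarrow> W i \<in> carrier_mat q p" "orthonormal_ops p r W" "j < r"
  shows "mat_adjoint (W j) * msum q p (\<lambda>i. c i \<cdot>\<^sub>m W i) {..<r} = c j \<cdot>\<^sub>m 1\<^sub>m p"
proof -
  have Wj: "mat_adjoint (W j) \<in> carrier_mat p q" using assms by auto
  have orth: "mat_adjoint (W j) * (c i \<cdot>\<^sub>m W i) = c i \<cdot>\<^sub>m (if j = i then 1\<^sub>m p else 0\<^sub>m p p)"
    if "i < r" for i
    using mult_smult_distrib[OF Wj assms(1)[OF that]] assms(2,3) that by (simp add: orthonormal_ops_def)
  have "mat_adjoint (W j) * msum q p (\<lambda>i. c i \<cdot>\<^sub>m W i) {..<r}
      = msum p p (\<lambda>i. mat_adjoint (W j) * (c i \<cdot>\<^sub>m W i)) {..<r}"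
    by (rule mult_msum[OF Wj]) (use assms in auto)
  also have "\<dots> = msum p p (\<lambda>i. c i \<cdot>\<^sub>m (if j = i then 1\<^sub>m p else 0\<^sub>m p p)) {..<r}"
    by (rule msum_cong) (simp add: orth)
  also have "\<dots> = c j \<cdot>\<^sub>m 1\<^sub>m p"
    by (subst msum_delta[of _ j]) (use assms in auto)
  finally show ?thesis .
qed

text \<open>Since products \<open>mat_adjoint X * Y\<close> within \<open>S\<close> are scalar, they
  play the role of inner products and the usual procedure works with scalar coefficients: subtract
  the components along the earlier \<open>W i\<close>, then normalize what remains unless it is
  zero.\<close>

lemma operator_gram_schmidt:
  fixes A :: "nat \<Rightarrow> complex mat"
  assumes p: "0 < p" and add: "\<And>X Y. X \<in> S \<Longrightarrow> Y \<in> S \<Longrightarrow> X + Y \<in> S"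
    and smult: "\<And>c X. X \<in> S \<Longrightarrow> c \<cdot>\<^sub>m X \<in> S" and S: "S \<subseteq> carrier_mat q p"
    and inner: "\<And>X Y. X \<in> S \<Longrightarrow> Y \<in> S \<Longrightarrow> \<exists>c. mat_adjoint X * Y = c \<cdot>\<^sub>m 1\<^sub>m p"
    and A: "\<And>k. k < K \<Longrightarrow> A k \<in> S"
  shows "\<exists>(r :: nat) W g. (\<forall>i<r. W i \<in> S) \<and> orthonormal_ops p r W \<and>
           (\<forall>k<K. A k = msum q p (\<lambda>i. g k i \<cdot>\<^sub>m W i) {..<r})"
  using A
proof (induction K)
  case 0
  show ?case by (intro exI[of _ 0]) (simp add: orthonormal_ops_def)
next
  case (Suc K)
  then obtain r W g where W: "\<And>i. i < r \<Longrightarrow> W i \<in> S" and orth: "orthonormal_ops p r W"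
    and g: "\<And>k. k < K \<Longrightarrow> A k = msum q p (\<lambda>i. g k i \<cdot>\<^sub>m W i) {..<r}"
    by (metis less_SucI)
  have AK: "A K \<in> S" using Suc.prems by simp
  have Wc: "W i \<in> carrier_mat q p" if "i < r" for i using W[OF that] S by auto
  have "\<forall>i. \<exists>s. i < r \<longrightarrow> mat_adjoint (W i) * A K = s \<cdot>\<^sub>m 1\<^sub>m p" using inner W AK by blast
  then obtain s where s: "\<And>i. i < r \<Longrightarrow> mat_adjoint (W i) * A K = s i \<cdot>\<^sub>m 1\<^sub>m p" by metis
  \<comment> \<open>The residual of \<open>A K\<close> after removing its components along the
    \<open>W i\<close>.\<close>
  define X where "X = A K + msum q p (\<lambda>i. - s i \<cdot>\<^sub>m W i) {..<r}"
  have XS: "X \<in> S"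
    unfolding X_def by (rule add_msum_closed[OF add smult S AK]) (use W in auto)
  then have X: "X \<in> carrier_mat q p" using S by auto
  have WX: "mat_adjoint (W j) * X = 0\<^sub>m p p" if j: "j < r" for j
  proof -
    have "mat_adjoint (W j) * X = s j \<cdot>\<^sub>m 1\<^sub>m p + - s j \<cdot>\<^sub>m 1\<^sub>m p"
      unfolding X_def using AK S
      by (subst mult_add_distrib_mat[OF mat_adjoint_carrier[OF Wc[OF j]]])
        (auto simp: s[OF j] adjoint_mult_msum[OF Wc orth j])
    also have "\<dots> = 0\<^sub>m p p" by (rule eq_matI) auto
    finally show ?thesis .
  qed
  have AX: "A K = msum q p (\<lambda>i. s i \<cdot>\<^sub>m W i) {..<r} + X"
    unfolding X_def using AK S Wc
    by (intro eq_matI) (auto simp: sum_negf carrier_matD[OF Wc] subset_iff)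
  obtain t where t: "mat_adjoint X * X = t \<cdot>\<^sub>m 1\<^sub>m p" using inner[OF XS XS] by blast
  \<comment> \<open>The squared norm of the residual, read off from column 0, which exists because
    \<open>p\<close> is positive. This shows that the scalar \<open>t\<close> is real and
    nonnegative.\<close>
  define u where "u = (\<Sum>x<q. (cmod (X $$ (x, 0)))\<^sup>2)"
  have tu: "t = of_real u"
    using adjoint_mult_self_diag[OF X p] p unfolding t u_def by simp
  have u: "0 \<le> u" unfolding u_def by (intro sum_nonneg) simp
  show ?case
  proof (cases "u = 0")
    \<comment> \<open>A zero residual adds no operator: \<open>A K\<close> already lies in the span
      of the \<open>W i\<close>.\<close>
    case True
    then have "mat_adjoint X * X = 0\<^sub>m p p" unfolding t tu by (intro eq_matI) auto
    then have "X = 0\<^sub>m q p" by (rule adjoint_mult_self_eq_0[OF X])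
    then have AK': "A K = msum q p (\<lambda>i. s i \<cdot>\<^sub>m W i) {..<r}" unfolding AX by simp
    show ?thesis
    proof (intro exI conjI allI impI)
      fix k assume "k < Suc K"
      then show "A k = msum q p (\<lambda>i. (if k = K then s else g k) i \<cdot>\<^sub>m W i) {..<r}"
        using g AK' by (cases "k = K") auto
    qed (use W orth in auto)
  next
    case False
    define c where "c = complex_of_real (sqrt u)"
    have c: "c \<noteq> 0" "cnj c = c" "c * c = t" using False u by (auto simp: c_def tu simp flip: of_real_mult)
    define V where "V = (1 / c) \<cdot>\<^sub>m X"
    have VS: "V \<in> S" unfolding V_def by (rule smult[OF XS])
    have V: "V \<in> carrier_mat q p" using VS S by auto
    have WV: "mat_adjoint (W j) * V = 0\<^sub>m p p" if "j < r" for j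
      unfolding V_def
      by (subst mult_smult_distrib[OF mat_adjoint_carrier[OF Wc[OF that]] X]) (simp add: WX[OF that] smult_zero_mat)
    have VW: "mat_adjoint V * W j = 0\<^sub>m p p" if "j < r" for j
      using arg_cong[OF WV[OF that], of mat_adjoint]
      by (simp add: mat_adjoint_mult[OF mat_adjoint_carrier[OF Wc[OF that]] V])
    have "mat_adjoint V * V = (1 / c * (1 / c)) \<cdot>\<^sub>m (mat_adjoint X * X)"
      unfolding V_def mat_adjoint_smult
      using X by (simp add: mult_smult_assoc_mat[of _ p q _ p] mult_smult_distrib[of _ p q _ p] smult_smult_mat c)
    also have "\<dots> = 1\<^sub>m p" unfolding t smult_smult_mat c(3)[symmetric] using c by (intro eq_matI) auto
    finally have VV: "mat_adjoint V * V = 1\<^sub>m p" .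
    let ?W = "W(r := V)"
    have W': "?W i \<in> S" if "i < Suc r" for i using that W VS by auto
    have msum_Suc: "msum q p (\<lambda>i. h i \<cdot>\<^sub>m ?W i) {..<Suc r} = msum q p (\<lambda>i. h i \<cdot>\<^sub>m W i) {..<r} + h r \<cdot>\<^sub>m V" for h
      using V by (intro eq_matI) auto
    show ?thesis
    proof (intro exI conjI allI impI)
      show "orthonormal_ops p (Suc r) ?W"
        using orth WV VW VV by (auto simp: orthonormal_ops_def less_Suc_eq)
      fix k assume k: "k < Suc K"
      \<comment> \<open>Only \<open>A K\<close> has a component along the new operator, namely the
        norm \<open>c\<close> of its residual; earlier operators get coefficient 0.\<close>
      show "A k = msum q p (\<lambda>i. (if k = K then s(r := c) else (g k)(r := 0)) i \<cdot>\<^sub>m ?W i) {..<Suc r}"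
      proof (cases "k = K")
        case True
        have "c \<cdot>\<^sub>m V = X" unfolding V_def smult_smult_mat using c X by (intro eq_matI) auto
        moreover have "msum q p (\<lambda>i. (s(r := c)) i \<cdot>\<^sub>m W i) {..<r} = msum q p (\<lambda>i. s i \<cdot>\<^sub>m W i) {..<r}"
          by (rule msum_cong) auto
        ultimately show ?thesis using True AX msum_Suc[of "s(r := c)"] by simp
      next
        case False
        have "msum q p (\<lambda>i. ((g k)(r := 0)) i \<cdot>\<^sub>m W i) {..<r} = msum q p (\<lambda>i. g k i \<cdot>\<^sub>m W i) {..<r}"
          by (rule msum_cong) auto
        moreover have "msum q p (\<lambda>i. g k i \<cdot>\<^sub>m W i) {..<r} + 0 \<cdot>\<^sub>m V = msum q p (\<lambda>i. g k i \<cdot>\<^sub>m W i) {..<r}"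
          using V by (intro eq_matI) auto
        ultimately show ?thesis using False g[of k] k msum_Suc[of "(g k)(r := 0)"] by simp
      qed
    qed (use W' in auto)
  qed
qed

subsection \<open>Extending isometries to unitaries\<close>

text \<open>Padding with zero rows to a square matrix makes the determinant vanish, which yields a
  nonzero kernel vector.\<close>

lemma wide_mat_kernel:
  fixes A :: "complex mat"
  assumes A: "A \<in> carrier_mat n m" and nm: "n < m"
  shows "\<exists>v\<in>carrier_vec m. v \<noteq> 0\<^sub>v m \<and> A *\<^sub>v v = 0\<^sub>v n"
proof -
  let ?f = "\<lambda>i. vec m (\<lambda>j. if i < n then A $$ (i, j) else 0)"
  \<comment> \<open>As \<open>n < m\<close>, row \<open>n\<close> belongs to the padding; singling
    it out exhibits the zero row for the determinant.\<close>
  define A' where "A' = mat\<^sub>r m m (\<lambda>i. if i = n then 0\<^sub>v m else ?f i)"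
  have A': "A' \<in> carrier_mat m m" by (simp add: A'_def)
  have "det A' = 0" unfolding A'_def by (rule det_row_0[OF nm]) auto
  then obtain v where v: "v \<in> carrier_vec m" "v \<noteq> 0\<^sub>v m" "A' *\<^sub>v v = 0\<^sub>v m"
    using det_0_iff_vec_prod_zero_field[OF A'] by blast
  have "A *\<^sub>v v = 0\<^sub>v n"
  proof (rule eq_vecI)
    fix i assume "i < dim_vec (0\<^sub>v n :: complex vec)"
    then have i: "i < n" by simp
    have "row A i = row A' i"
      using i nm A by (intro eq_vecI) (auto simp: A'_def)
    then have "(A *\<^sub>v v) $ i = (A' *\<^sub>v v) $ i" using i nm A A' by simp
    then show "(A *\<^sub>v v) $ i = 0\<^sub>v n $ i" using v(3) i nm by simp
  qed (use A in auto)
  with v show ?thesis by blast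
qed

lemma isometry_mat_iff:
  "isometry_mat q n X \<longleftrightarrow> X \<in> carrier_mat q n \<and>
     (\<forall>i<n. \<forall>j<n. (\<Sum>k<q. cnj (X $$ (k, i)) * X $$ (k, j)) = (if i = j then 1 else 0))"
proof -
  have "(mat_adjoint X * X) $$ (i, j) = (\<Sum>k<q. cnj (X $$ (k, i)) * X $$ (k, j))"
    if "X \<in> carrier_mat q n" "i < n" "j < n" for i j
    unfolding index_mult_mat_sum[OF mat_adjoint_carrier[OF that(1)] that]
    by (intro sum.cong refl) (use that in auto)
  then have "mat_adjoint X * X = 1\<^sub>m n \<longleftrightarrow>
      (\<forall>i<n. \<forall>j<n. (\<Sum>k<q. cnj (X $$ (k, i)) * X $$ (k, j)) = (if i = j then 1 else 0))"
    if "X \<in> carrier_mat q n"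
    using that by (auto simp: mat_eq_iff simp del: index_mult_mat(1))
  then show ?thesis unfolding isometry_mat_def by blast
qed

text \<open>A matrix with more columns than rows kills a nonzero vector, whereas an isometry is
  injective.\<close>

lemma isometry_mat_dim_le:
  assumes "isometry_mat q n X"
  shows "n \<le> q"
proof (rule ccontr)
  assume "\<not> n \<le> q"
  have X: "X \<in> carrier_mat q n" "mat_adjoint X * X = 1\<^sub>m n" using assms by (auto simp: isometry_mat_def)
  obtain v where v: "v \<in> carrier_vec n" "v \<noteq> 0\<^sub>v n" "X *\<^sub>v v = 0\<^sub>v q"
    using wide_mat_kernel[OF X(1)] \<open>\<not> n \<le> q\<close> by auto
  have "v = (mat_adjoint X * X) *\<^sub>v v" using v X(2) by simp
  also have "\<dots> = mat_adjoint X *\<^sub>v (X *\<^sub>v v)"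
    by (rule assoc_mult_mat_vec[OF mat_adjoint_carrier[OF X(1)] X(1) v(1)])
  also have "\<dots> = 0\<^sub>v n" using X(1) unfolding v(3) by auto
  finally show False using v by simp
qed

text \<open>The adjoint of \<open>X\<close> has fewer rows than columns, so it kills some nonzero
  \<open>v\<close>, that is, \<open>v\<close> is orthogonal to all columns of \<open>X\<close>.
  Normalized, it becomes the new last column.\<close>

lemma isometry_mat_extend_one:
  assumes "isometry_mat q n X" and nq: "n < q"
  shows "\<exists>Y. isometry_mat q (Suc n) Y \<and> (\<forall>i<q. \<forall>j<n. Y $$ (i, j) = X $$ (i, j))"
proof -
  have X: "X \<in> carrier_mat q n"
    and orth: "\<And>i j. i < n \<Longrightarrow> j < n \<Longrightarrow> (\<Sum>k<q. cnj (X $$ (k, i)) * X $$ (k, j)) = (if i = j then 1 else 0)"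
    using assms by (auto simp: isometry_mat_iff)
  obtain v where v: "v \<in> carrier_vec q" "v \<noteq> 0\<^sub>v q" "mat_adjoint X *\<^sub>v v = 0\<^sub>v n"
    using wide_mat_kernel[OF mat_adjoint_carrier[OF X] nq] by blast
  have Xv: "(\<Sum>k<q. cnj (X $$ (k, i)) * v $ k) = 0" if "i < n" for i
    using arg_cong[OF v(3), of "\<lambda>w. w $ i"] that X v(1)
    by (simp add: scalar_prod_def lessThan_atLeast0)
  define N where "N = (\<Sum>k<q. (cmod (v $ k))\<^sup>2)"
  have "N \<noteq> 0"
  proof
    assume "N = 0"
    then have "v = 0\<^sub>v q" using v(1) by (intro eq_vecI) (auto simp: N_def sum_nonneg_eq_0_iff)
    with v show False by simp
  qed
  then have N: "N > 0" by (simp add: N_def sum_nonneg less_le)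
  define c where "c = complex_of_real (sqrt N)"
  have c: "c \<noteq> 0" "cnj c = c" "c * c = of_real N" using N by (auto simp: c_def simp flip: of_real_mult)
  have vv: "(\<Sum>k<q. cnj (v $ k) * v $ k) = c * c"
    unfolding c N_def of_real_sum complex_norm_square by (intro sum.cong refl mult.commute)
  define Y where "Y = mat q (Suc n) (\<lambda>(i, j). if j < n then X $$ (i, j) else v $ i / c)"
  have "(\<Sum>k<q. cnj (Y $$ (k, i)) * Y $$ (k, j)) = (if i = j then 1 else 0)"
    if ij: "i < Suc n" "j < Suc n" for i j
  proof -
    consider "i < n" "j < n" | "i < n" "j = n" | "i = n" "j < n" | "i = n" "j = n" using ij by linarith
    then show ?thesis
    proof cases
      case 1
      then show ?thesis using orth by (simp add: Y_def)
    next
      case 2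
      then show ?thesis using Xv[of i] by (simp add: Y_def flip: sum_divide_distrib)
    next
      case 3
      have "(\<Sum>k<q. cnj (v $ k) * X $$ (k, j)) = cnj (\<Sum>k<q. cnj (X $$ (k, j)) * v $ k)"
        by (simp add: mult.commute)
      then show ?thesis using Xv[of j] 3 by (simp add: Y_def c(2) flip: sum_divide_distrib)
    next
      case 4
      then show ?thesis using vv c(1,2) by (simp add: Y_def flip: sum_divide_distrib)
    qed
  qed
  then have "isometry_mat q (Suc n) Y" unfolding isometry_mat_iff by (simp add: Y_def)
  moreover have "\<forall>i<q. \<forall>j<n. Y $$ (i, j) = X $$ (i, j)" by (simp add: Y_def)
  ultimately show ?thesis by blast
qed

lemma isometry_mat_extend:
  assumes "isometry_mat q n X" "n \<le> m" "m \<le> q"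
  shows "\<exists>Y. isometry_mat q m Y \<and> (\<forall>i<q. \<forall>j<n. Y $$ (i, j) = X $$ (i, j))"
  using assms(2,3)
proof (induction m rule: dec_induct)
  case base
  then show ?case using assms(1) by blast
next
  case (step m)
  then obtain Y where "isometry_mat q m Y" and Y: "\<forall>i<q. \<forall>j<n. Y $$ (i, j) = X $$ (i, j)" by auto
  from isometry_mat_extend_one[OF this(1)] step obtain Z where
    "isometry_mat q (Suc m) Z" "\<forall>i<q. \<forall>j<m. Z $$ (i, j) = Y $$ (i, j)" by auto
  with Y step show ?case by (intro exI[of _ Z]) auto
qed

lemma isometry_mat_unitary: "isometry_mat n n U \<Longrightarrow> unitary_mat n U"
  unfolding isometry_mat_def unitary_mat_def
  using mat_mult_left_right_inverse[OF mat_adjoint_carrier] by blast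

lemma unitary_mat_mult:
  assumes "unitary_mat n U" "unitary_mat n W"
  shows "unitary_mat n (U * mat_adjoint W)"
proof -
  have c: "U \<in> carrier_mat n n" "W \<in> carrier_mat n n" "mat_adjoint U \<in> carrier_mat n n"
    "mat_adjoint W \<in> carrier_mat n n" using assms by (auto simp: unitary_mat_def)
  have "mat_adjoint (U * mat_adjoint W) * (U * mat_adjoint W) = W * (mat_adjoint U * U) * mat_adjoint W"
    using c by (simp add: mat_adjoint_mult[OF c(1,4)] assoc_mult_mat[of _ n n _ n _ n] mult_carrier_mat[of _ n n])
  also have "\<dots> = 1\<^sub>m n" using assms c by (simp add: unitary_mat_def)
  finally show ?thesis using c by (intro isometry_mat_unitary) (auto simp: isometry_mat_def)
qed

text \<open>Complete both isometries to unitaries \<open>X'\<close> and \<open>Y'\<close>; then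
  \<open>Y' * mat_adjoint X'\<close> carries the columns of \<open>X\<close> to those of
  \<open>Y\<close>.\<close>

lemma unitary_between_isometries:
  assumes X: "isometry_mat q n X" and Y: "isometry_mat q n Y"
  shows "\<exists>U. unitary_mat q U \<and> U * X = Y"
proof -
  have nq: "n \<le> q" using X by (rule isometry_mat_dim_le)
  obtain X' where X': "isometry_mat q q X'" "\<And>i j. i < q \<Longrightarrow> j < n \<Longrightarrow> X' $$ (i, j) = X $$ (i, j)"
    using isometry_mat_extend[OF X nq] by blast
  obtain Y' where Y': "isometry_mat q q Y'" "\<And>i j. i < q \<Longrightarrow> j < n \<Longrightarrow> Y' $$ (i, j) = Y $$ (i, j)"
    using isometry_mat_extend[OF Y nq] by blast
  \<comment> \<open>Inclusion of the first \<open>n\<close> coordinates; right multiplication by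
    \<open>J\<close> keeps the first \<open>n\<close> columns.\<close>
  define J :: "complex mat" where "J = mat q n (\<lambda>(i, j). if i = j then 1 else 0)"
  have J: "J \<in> carrier_mat q n" by (simp add: J_def)
  have XJ: "Z' * J = Z" if "Z' \<in> carrier_mat q q" "Z \<in> carrier_mat q n"
    "\<And>i j. i < q \<Longrightarrow> j < n \<Longrightarrow> Z' $$ (i, j) = Z $$ (i, j)" for Z Z' :: "complex mat"
  proof (rule eq_matI)
    fix i j assume "i < dim_row Z" "j < dim_col Z"
    then have ij: "i < q" "j < n" using that by auto
    have "(Z' * J) $$ (i, j) = (\<Sum>k<q. Z' $$ (i, k) * (if k = j then 1 else 0))"
      unfolding index_mult_mat_sum[OF that(1) J ij] by (intro sum.cong refl) (use ij in \<open>simp add: J_def\<close>)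
    also have "\<dots> = Z $$ (i, j)" using ij nq that(3) by (simp add: if_distrib[of "\<lambda>x. _ * x"] cong: if_cong)
    finally show "(Z' * J) $$ (i, j) = Z $$ (i, j)" .
  qed (use that J in auto)
  have c: "X' \<in> carrier_mat q q" "Y' \<in> carrier_mat q q" "X \<in> carrier_mat q n" "Y \<in> carrier_mat q n"
    "mat_adjoint X' \<in> carrier_mat q q" "mat_adjoint X' * X' = 1\<^sub>m q"
    using X Y X' Y' by (auto simp: isometry_mat_def)
  have "Y' * mat_adjoint X' * X = Y' * mat_adjoint X' * (X' * J)"
    using XJ[OF c(1,3) X'(2)] by simp
  also have "\<dots> = Y' * (mat_adjoint X' * X') * J"
    using c(1,2,5) J by (simp add: assoc_mult_mat[of _ q q _ q _ n] assoc_mult_mat[of _ q q _ q _ q]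
        mult_carrier_mat[of _ q q])
  also have "\<dots> = Y" using c XJ[OF c(2,4) Y'(2)] by simp
  finally show ?thesis
    using unitary_mat_mult[OF isometry_mat_unitary[OF Y'(1)] isometry_mat_unitary[OF X'(1)]] by blast
qed

lemma sum_mult_index: "(\<Sum>s<p * m. f s) = (\<Sum>a<p. \<Sum>i<m. f (a * m + i))" for p m :: nat
proof (induction p)
  case (Suc p)
  have "(\<Sum>s<Suc p * m. f s) = (\<Sum>s<p * m. f s) + (\<Sum>s\<in>{p * m..<p * m + m}. f s)"
    by (subst sum.union_disjoint[symmetric]) (auto intro!: sum.cong)
  also have "(\<Sum>s\<in>{p * m..<p * m + m}. f s) = (\<Sum>i<m. f (p * m + i))"
    by (rule sum.reindex_bij_witness[of _ "\<lambda>i. p * m + i" "\<lambda>s. s - p * m"]) auto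
  finally show ?case using Suc by simp
qed simp

subsection \<open>Slices of an operator on a tensor product\<close>

text \<open>The operator \<open>\<complex>\<^sup>p \<rightarrow> \<complex>\<^sup>q\<close> sending \<open>e\<^sub>a\<close> to \<open>T (e\<^sub>a \<otimes> e\<^sub>i)\<close>.\<close>

definition slice :: "nat \<Rightarrow> nat \<Rightarrow> complex mat \<Rightarrow> nat \<Rightarrow> complex mat" where
  "slice p m T i = mat (dim_row T) p (\<lambda>(x, a). T $$ (x, a * m + i))"

lemma slice_carrier [simp]: "T \<in> carrier_mat q n \<Longrightarrow> slice p m T i \<in> carrier_mat q p"
  by (simp add: slice_def)

text \<open>Expand \<omega> into matrix units on the ancilla: conjugating \<rho> tensored with the
  unit at \<open>(i, j)\<close> by \<open>T\<close> involves only slice \<open>i\<close> on the left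
  and slice \<open>j\<close> on the right.\<close>

lemma conj_kron:
  assumes T: "T \<in> carrier_mat q (p * m)" and \<rho>: "\<rho> \<in> carrier_mat p p" and \<omega>: "\<omega> \<in> carrier_mat m m"
  shows "T * kron \<rho> \<omega> * mat_adjoint T = msum q q
    (\<lambda>ij. \<omega> $$ ij \<cdot>\<^sub>m (slice p m T (fst ij) * \<rho> * mat_adjoint (slice p m T (snd ij)))) ({..<m} \<times> {..<m})"
    (is "?L = ?R")
proof (rule eq_matI)
  fix x y assume "x < dim_row ?R" "y < dim_col ?R"
  then have xy: "x < q" "y < q" by auto
  have K: "kron \<rho> \<omega> \<in> carrier_mat (p * m) (p * m)" using \<rho> \<omega> by (simp add: kron_def)
  have kron: "kron \<rho> \<omega> $$ (a * m + i, b * m + j) = \<rho> $$ (a, b) * \<omega> $$ (i, j)"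
    if "a < p" "b < p" "i < m" "j < m" for a b i j
    using that \<rho> \<omega> by (simp add: kron_def less_mult_add)
  let ?t = "\<lambda>a b i j. T $$ (x, a * m + i) * (\<rho> $$ (a, b) * \<omega> $$ (i, j)) * cnj (T $$ (y, b * m + j))"
  have "?L $$ (x, y) = (\<Sum>a<p. \<Sum>i<m. \<Sum>b<p. \<Sum>j<m. ?t a b i j)"
    unfolding index_mult_adjoint[OF T K T xy] sum_mult_index by (intro sum.cong refl) (simp add: kron)
  also have "\<dots> = (\<Sum>i<m. \<Sum>j<m. \<Sum>a<p. \<Sum>b<p. ?t a b i j)"
  proof -
    have "(\<Sum>a<p. \<Sum>i<m. \<Sum>b<p. \<Sum>j<m. ?t a b i j) = (\<Sum>i<m. \<Sum>a<p. \<Sum>b<p. \<Sum>j<m. ?t a b i j)"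
      by (rule sum.swap)
    then show ?thesis by (simp only: sum_swap3[of _ "{..<m}"])
  qed
  also have "\<dots> = (\<Sum>i<m. \<Sum>j<m. \<omega> $$ (i, j) *
      (slice p m T i * \<rho> * mat_adjoint (slice p m T j)) $$ (x, y))"
  proof (intro sum.cong refl)
    fix i j
    show "(\<Sum>a<p. \<Sum>b<p. ?t a b i j)
        = \<omega> $$ (i, j) * (slice p m T i * \<rho> * mat_adjoint (slice p m T j)) $$ (x, y)"
      unfolding index_mult_adjoint[OF slice_carrier[OF T] \<rho> slice_carrier[OF T] xy] sum_distrib_left
      using T xy by (intro sum.cong refl) (simp add: slice_def)
  qed
  also have "\<dots> = ?R $$ (x, y)"
    using xy T \<rho> by (simp add: sum.cartesian_product case_prod_beta carrier_matD[OF slice_carrier[OF T]] del: index_mult_mat(1))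
  finally show "?L $$ (x, y) = ?R $$ (x, y)" .
qed (use assms in auto)

text \<open>Entry \<open>(a * m + i, b * m + i)\<close> of the conjugated operator is entry
  \<open>(a, b)\<close> of its conjugation by slice \<open>i\<close>, so the partial trace becomes a
  sum over slices.\<close>

lemma ptrace2_conj:
  assumes T: "T \<in> carrier_mat q (p * m)" and \<tau>: "\<tau> \<in> carrier_mat q q"
  shows "ptrace2 p m (mat_adjoint T * \<tau> * T)
    = msum p p (\<lambda>i. mat_adjoint (slice p m T i) * \<tau> * slice p m T i) {..<m}" (is "?L = ?R")
proof (rule eq_matI)
  fix a b assume "a < dim_row ?R" "b < dim_col ?R"
  then have ab: "a < p" "b < p" by auto
  have "(mat_adjoint T * \<tau> * T) $$ (a * m + i, b * m + i)
      = (mat_adjoint (slice p m T i) * \<tau> * slice p m T i) $$ (a, b)" if i: "i < m" for i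
  proof -
    let ?S = "slice p m T i"
    have S: "?S \<in> carrier_mat q p" using T by simp
    \<comment> \<open>The last factor is written as a double adjoint to fit the shape of
      \<open>index_mult_adjoint\<close>.\<close>
    have "(mat_adjoint T * \<tau> * mat_adjoint (mat_adjoint T)) $$ (a * m + i, b * m + i)
        = (mat_adjoint ?S * \<tau> * mat_adjoint (mat_adjoint ?S)) $$ (a, b)"
      unfolding index_mult_adjoint[OF mat_adjoint_carrier[OF T] \<tau> mat_adjoint_carrier[OF T]
          less_mult_add[OF ab(1) i] less_mult_add[OF ab(2) i]]
        index_mult_adjoint[OF mat_adjoint_carrier[OF S] \<tau> mat_adjoint_carrier[OF S] ab]
      using T ab i by (intro sum.cong refl) (simp add: slice_def less_mult_add)
    then show ?thesis by simp
  qed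
  then show "?L $$ (a, b) = ?R $$ (a, b)" using ab by (simp add: ptrace2_def del: index_mult_mat(1))
qed (simp_all add: ptrace2_def)

text \<open>Column \<open>a * m + i\<close> of \<open>T\<close> is column \<open>a\<close> of slice
  \<open>i\<close>, so this regroups orthonormality of the columns;
  \<open>orthonormal_slices_isometry\<close> regroups it back.\<close>

lemma isometry_orthonormal_slices:
  assumes T: "isometry_mat q (p * m) T"
  shows "orthonormal_ops p m (slice p m T)"
  unfolding orthonormal_ops_def
proof (intro allI impI)
  fix i j assume ij: "i < m" "j < m"
  have Tc: "T \<in> carrier_mat q (p * m)" using T by (simp add: isometry_mat_def)
  show "mat_adjoint (slice p m T i) * slice p m T j = (if i = j then 1\<^sub>m p else 0\<^sub>m p p)" (is "?L = ?R")
  proof (rule eq_matI)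
    fix a b assume "a < dim_row ?R" "b < dim_col ?R"
    then have ab: "a < p" "b < p" by (auto split: if_splits)
    have "?L $$ (a, b) = (\<Sum>x<q. cnj (T $$ (x, a * m + i)) * T $$ (x, b * m + j))"
      unfolding index_mult_mat_sum[OF mat_adjoint_carrier[OF slice_carrier[OF Tc]] slice_carrier[OF Tc] ab]
      by (intro sum.cong refl) (use ab Tc in \<open>simp add: slice_def\<close>)
    also have "\<dots> = (if a * m + i = b * m + j then 1 else 0)"
      using T ab ij by (simp add: isometry_mat_iff less_mult_add)
    also have "a * m + i = b * m + j \<longleftrightarrow> a = b \<and> i = j"
    proof
      assume eq: "a * m + i = b * m + j"
      have "a = b" using arg_cong[OF eq, of "\<lambda>n. n div m"] ij by simp
      with eq show "a = b \<and> i = j" by simp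
    qed simp
    finally show "?L $$ (a, b) = ?R $$ (a, b)" using ab by auto
  qed (auto simp: carrier_matD[OF slice_carrier[OF Tc]])
qed

lemma orthonormal_slices_isometry:
  assumes T: "T \<in> carrier_mat q (p * m)" and orth: "orthonormal_ops p m (slice p m T)"
  shows "isometry_mat q (p * m) T"
  unfolding isometry_mat_iff
proof (intro conjI allI impI)
  fix r s assume rs: "r < p * m" "s < p * m"
  then have m: "0 < m" by (cases m) auto
  let ?S = "slice p m T"
  have d: "r div m < p" "s div m < p" "r mod m < m" "s mod m < m"
    using rs m by (auto simp: less_mult_imp_div_less)
  have "(mat_adjoint (?S (r mod m)) * ?S (s mod m)) $$ (r div m, s div m)
      = (\<Sum>x<q. cnj (T $$ (x, r)) * T $$ (x, s))"
    unfolding index_mult_mat_sum[OF mat_adjoint_carrier[OF slice_carrier[OF T]] slice_carrier[OF T] d(1,2)]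
    by (intro sum.cong refl) (use d T in \<open>simp add: slice_def\<close>)
  moreover have "(mat_adjoint (?S (r mod m)) * ?S (s mod m)) $$ (r div m, s div m)
      = (if r mod m = s mod m \<and> r div m = s div m then 1 else 0)"
    using orth d by (simp add: orthonormal_ops_def del: index_mult_mat(1))
  moreover have "r mod m = s mod m \<and> r div m = s div m \<longleftrightarrow> r = s"
    by (metis div_mult_mod_eq)
  ultimately show "(\<Sum>x<q. cnj (T $$ (x, r)) * T $$ (x, s)) = (if r = s then 1 else 0)" by simp
qed (use T in simp)

section \<open>Sums of conjugations by operators in a common span\<close>

lemma conj_span:
  assumes Z: "\<And>i. i \<in> I \<Longrightarrow> Z i \<in> carrier_mat n m" and X: "X \<in> carrier_mat m m"
    and F: "F = msum n m (\<lambda>i. h i \<cdot>\<^sub>m Z i) I"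
  shows "F * X * mat_adjoint F
    = msum n n (\<lambda>i. msum n n (\<lambda>j. (h i * cnj (h j)) \<cdot>\<^sub>m (Z i * X * mat_adjoint (Z j))) I) I"
proof -
  have Fc: "mat_adjoint F \<in> carrier_mat m n" unfolding F by auto
  have ZX: "Z i * X \<in> carrier_mat n m" if "i \<in> I" for i using Z[OF that] X by auto
  have "F * X = msum n m (\<lambda>i. h i \<cdot>\<^sub>m Z i * X) I"
    unfolding F by (rule msum_mult[OF X]) (use Z in auto)
  also have "\<dots> = msum n m (\<lambda>i. h i \<cdot>\<^sub>m (Z i * X)) I"
    by (rule msum_cong) (use Z X in \<open>auto simp: mult_smult_assoc_mat[of _ n m _ m]\<close>)
  finally have "F * X * mat_adjoint F = msum n n (\<lambda>i. h i \<cdot>\<^sub>m (Z i * X) * mat_adjoint F) I"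
    using msum_mult[OF Fc, of I "\<lambda>i. h i \<cdot>\<^sub>m (Z i * X)" n] ZX by simp
  also have "\<dots> = msum n n (\<lambda>i. msum n n (\<lambda>j. (h i * cnj (h j)) \<cdot>\<^sub>m (Z i * X * mat_adjoint (Z j))) I) I"
  proof (rule msum_cong)
    fix i assume i: "i \<in> I"
    have "mat_adjoint F = msum m n (\<lambda>j. cnj (h j) \<cdot>\<^sub>m mat_adjoint (Z j)) I"
      unfolding F by (subst mat_adjoint_msum) (use Z in \<open>auto simp: mat_adjoint_smult\<close>)
    then have "h i \<cdot>\<^sub>m (Z i * X) * mat_adjoint F
        = msum n n (\<lambda>j. h i \<cdot>\<^sub>m (Z i * X) * (cnj (h j) \<cdot>\<^sub>m mat_adjoint (Z j))) I"
      using mult_msum[of "h i \<cdot>\<^sub>m (Z i * X)" n m I "\<lambda>j. cnj (h j) \<cdot>\<^sub>m mat_adjoint (Z j)" n] ZX[OF i] Z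
      by simp
    also have "\<dots> = msum n n (\<lambda>j. (h i * cnj (h j)) \<cdot>\<^sub>m (Z i * X * mat_adjoint (Z j))) I"
    proof (rule msum_cong)
      fix j assume j: "j \<in> I"
      have Zj: "mat_adjoint (Z j) \<in> carrier_mat m n" using Z[OF j] by auto
      have "h i \<cdot>\<^sub>m (Z i * X) * (cnj (h j) \<cdot>\<^sub>m mat_adjoint (Z j))
          = h i \<cdot>\<^sub>m (Z i * X * (cnj (h j) \<cdot>\<^sub>m mat_adjoint (Z j)))"
        by (rule mult_smult_assoc_mat[OF ZX[OF i] smult_carrier_mat[OF Zj]])
      also have "Z i * X * (cnj (h j) \<cdot>\<^sub>m mat_adjoint (Z j)) = cnj (h j) \<cdot>\<^sub>m (Z i * X * mat_adjoint (Z j))"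
        by (rule mult_smult_distrib[OF ZX[OF i] Zj])
      finally show "h i \<cdot>\<^sub>m (Z i * X) * (cnj (h j) \<cdot>\<^sub>m mat_adjoint (Z j))
          = (h i * cnj (h j)) \<cdot>\<^sub>m (Z i * X * mat_adjoint (Z j))"
        by (simp only: smult_smult_mat)
    qed
    finally show "h i \<cdot>\<^sub>m (Z i * X) * mat_adjoint F
        = msum n n (\<lambda>j. (h i * cnj (h j)) \<cdot>\<^sub>m (Z i * X * mat_adjoint (Z j))) I" .
  qed
  finally show ?thesis .
qed

text \<open>Such a sum depends on the coefficients \<open>h\<close> only through the Gram-type
  matrix of sums of \<open>h k i * cnj (h k j)\<close> over \<open>k\<close>. For the encoder this
  matrix becomes the ancilla state; for the decoder it turns out to be the identity.\<close>

lemma conj_span_sum: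
  assumes Z: "\<And>i. i \<in> I \<Longrightarrow> Z i \<in> carrier_mat n m" and X: "X \<in> carrier_mat m m"
    and F: "\<And>k. k \<in> J \<Longrightarrow> F k = msum n m (\<lambda>i. h k i \<cdot>\<^sub>m Z i) I"
  shows "msum n n (\<lambda>k. F k * X * mat_adjoint (F k)) J
    = msum n n (\<lambda>ij. (\<Sum>k\<in>J. h k (fst ij) * cnj (h k (snd ij))) \<cdot>\<^sub>m
        (Z (fst ij) * X * mat_adjoint (Z (snd ij)))) (I \<times> I)" (is "?L = ?R")
proof -
  have "?L = msum n n (\<lambda>k. msum n n (\<lambda>i. msum n n
      (\<lambda>j. (h k i * cnj (h k j)) \<cdot>\<^sub>m (Z i * X * mat_adjoint (Z j))) I) I) J"
    by (rule msum_cong, rule conj_span[OF Z X F])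
  also have "\<dots> = ?R"
  proof (rule eq_matI)
    fix x y assume "x < dim_row ?R" "y < dim_col ?R"
    then have xy: "x < n" "y < n" by auto
    have smult: "(c \<cdot>\<^sub>m (Z i * X * mat_adjoint (Z j))) $$ (x, y) = c * (Z i * X * mat_adjoint (Z j)) $$ (x, y)"
      if "i \<in> I" "j \<in> I" for c i j
      by (rule index_smult_mat(1)) (use xy Z that in auto)
    let ?t = "\<lambda>i j k. h k i * cnj (h k j) * (Z i * X * mat_adjoint (Z j)) $$ (x, y)"
    have "msum n n (\<lambda>k. msum n n (\<lambda>i. msum n n
        (\<lambda>j. (h k i * cnj (h k j)) \<cdot>\<^sub>m (Z i * X * mat_adjoint (Z j))) I) I) J $$ (x, y)
      = (\<Sum>k\<in>J. \<Sum>i\<in>I. \<Sum>j\<in>I. ?t i j k)"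
      unfolding index_msum[OF xy] by (intro sum.cong refl) (rule smult)
    also have "\<dots> = (\<Sum>i\<in>I. \<Sum>j\<in>I. \<Sum>k\<in>J. ?t i j k)"
      by (rule sum_swap3[symmetric])
    also have "\<dots> = (\<Sum>i\<in>I. \<Sum>j\<in>I. (\<Sum>k\<in>J. h k i * cnj (h k j)) *
        (Z i * X * mat_adjoint (Z j)) $$ (x, y))"
      by (simp only: sum_distrib_right)
    also have "\<dots> = (\<Sum>ij\<in>I \<times> I. (\<Sum>k\<in>J. h k (fst ij) * cnj (h k (snd ij))) *
        (Z (fst ij) * X * mat_adjoint (Z (snd ij))) $$ (x, y))"
      by (simp only: sum.cartesian_product case_prod_unfold)
    also have "\<dots> = ?R $$ (x, y)"
      unfolding index_msum[OF xy] by (intro sum.cong refl smult[symmetric]) auto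
    finally show "msum n n (\<lambda>k. msum n n (\<lambda>i. msum n n
        (\<lambda>j. (h k i * cnj (h k j)) \<cdot>\<^sub>m (Z i * X * mat_adjoint (Z j))) I) I) J $$ (x, y) = ?R $$ (x, y)" .
  qed auto
  finally show ?thesis .
qed

section \<open>Aligning the embedding with an orthonormal family of operators\<close>

lemma slice_mult:
  assumes "U \<in> carrier_mat n q" "T \<in> carrier_mat q (p * m)" "i < m"
  shows "slice p m (U * T) i = U * slice p m T i" (is "?L = ?R")
proof (rule eq_matI)
  fix x a assume "x < dim_row ?R" "a < dim_col ?R"
  then have xa: "x < n" "a < p" using assms by (auto simp: slice_def)
  have "?L $$ (x, a) = (U * T) $$ (x, a * m + i)"
    using xa assms by (simp add: slice_def)
  also have "\<dots> = ?R $$ (x, a)"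
    unfolding index_mult_mat_sum[OF assms(1,2) xa(1) less_mult_add[OF xa(2) assms(3)]]
      index_mult_mat_sum[OF assms(1) slice_carrier[OF assms(2)] xa]
    using xa assms by (simp add: slice_def)
  finally show "?L $$ (x, a) = ?R $$ (x, a)" .
qed (use assms in \<open>auto simp: slice_def\<close>)

text \<open>The \<open>W i\<close> are packed into one isometry with \<open>p * r\<close> columns,
  which forces \<open>p * r \<le> q\<close>. The columns of \<open>V\<close> with ancilla index
  below \<open>r\<close> form another isometry of the same shape, and a unitary takes the latter to
  the former.\<close>

lemma align_slices:
  assumes p: "0 < p" and V: "isometry_mat q (p * (q div p)) V"
    and W: "\<And>i. i < r \<Longrightarrow> W i \<in> carrier_mat q p" and orth: "orthonormal_ops p r W"
  shows "r \<le> q div p \<and> (\<exists>U. unitary_mat q U \<and> (\<forall>i<r. slice p (q div p) (U * V) i = W i))"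
proof -
  define m where "m = q div p"
  have Vc: "V \<in> carrier_mat q (p * m)" using V by (simp add: isometry_mat_def m_def)
  \<comment> \<open>Column \<open>a * r + i\<close> is column \<open>a\<close> of
    \<open>W i\<close>.\<close>
  define T0 where "T0 = mat q (p * r) (\<lambda>(x, s). W (s mod r) $$ (x, s div r))"
  have T0: "T0 \<in> carrier_mat q (p * r)" by (simp add: T0_def)
  have slT0: "slice p r T0 i = W i" if "i < r" for i
    using W[OF that] that by (intro eq_matI) (auto simp: slice_def T0_def less_mult_add)
  have isoT0: "isometry_mat q (p * r) T0"
    by (rule orthonormal_slices_isometry[OF T0]) (use orth in \<open>auto simp: orthonormal_ops_def slT0\<close>)
  then have "p * r \<le> q" by (rule isometry_mat_dim_le)
  then have rm: "r \<le> m" using p by (simp add: m_def less_eq_div_iff_mult_less_eq mult.commute)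
  \<comment> \<open>Selects the first \<open>r\<close> slices of \<open>V\<close>, which changes the
    stride of the column index from \<open>m\<close> to \<open>r\<close>.\<close>
  define V1 where "V1 = mat q (p * r) (\<lambda>(x, s). V $$ (x, (s div r) * m + s mod r))"
  have V1: "V1 \<in> carrier_mat q (p * r)" by (simp add: V1_def)
  have slV1: "slice p r V1 i = slice p m V i" if "i < r" for i
    using that Vc by (intro eq_matI) (auto simp: slice_def V1_def less_mult_add)
  have "orthonormal_ops p m (slice p m V)"
    using V unfolding m_def by (rule isometry_orthonormal_slices)
  then have "isometry_mat q (p * r) V1"
    by (intro orthonormal_slices_isometry[OF V1]) (use rm in \<open>auto simp: orthonormal_ops_def slV1\<close>)
  from unitary_between_isometries[OF this isoT0] obtain U where
    U: "unitary_mat q U" "U * V1 = T0" by blast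
  have Uc: "U \<in> carrier_mat q q" using U by (simp add: unitary_mat_def)
  have "slice p m (U * V) i = W i" if i: "i < r" for i
  proof -
    have "slice p m (U * V) i = U * slice p m V i" using slice_mult[OF Uc Vc] i rm by simp
    also have "\<dots> = slice p r (U * V1) i" using slice_mult[OF Uc V1 i] slV1[OF i] by simp
    finally show ?thesis using U(2) slT0[OF i] by simp
  qed
  with rm U(1) show ?thesis unfolding m_def by blast
qed

text \<open>Pythagoras for the scalar-valued products of an orthonormal family.\<close>

lemma span_adjoint_mult_self:
  assumes Z: "\<And>i. i < m \<Longrightarrow> Z i \<in> carrier_mat q p" and orth: "orthonormal_ops p m Z"
    and A: "A = msum q p (\<lambda>i. h i \<cdot>\<^sub>m Z i) {..<m}"
  shows "mat_adjoint A * A = (\<Sum>i<m. h i * cnj (h i)) \<cdot>\<^sub>m 1\<^sub>m p"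
proof -
  have Ac: "A \<in> carrier_mat q p" unfolding A by auto
  have AZ: "mat_adjoint A * Z i = cnj (h i) \<cdot>\<^sub>m 1\<^sub>m p" if "i < m" for i
    using arg_cong[OF adjoint_mult_msum[OF Z orth that, of h, folded A], of mat_adjoint]
    by (simp add: mat_adjoint_mult[OF mat_adjoint_carrier[OF Z[OF that]] Ac] mat_adjoint_smult)
  have "mat_adjoint A * A = mat_adjoint A * msum q p (\<lambda>i. h i \<cdot>\<^sub>m Z i) {..<m}"
    using A by simp
  also have "\<dots> = msum p p (\<lambda>i. mat_adjoint A * (h i \<cdot>\<^sub>m Z i)) {..<m}"
    by (rule mult_msum[OF mat_adjoint_carrier[OF Ac]]) (use Z in auto)
  also have "\<dots> = msum p p (\<lambda>i. (h i * cnj (h i)) \<cdot>\<^sub>m 1\<^sub>m p) {..<m}"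
    by (rule msum_cong)
      (simp add: mult_smult_distrib[OF mat_adjoint_carrier[OF Ac] Z] AZ smult_smult_mat)
  also have "\<dots> = (\<Sum>i<m. h i * cnj (h i)) \<cdot>\<^sub>m 1\<^sub>m p"
    by (rule msum_smult_const) auto
  finally show ?thesis .
qed

subsection \<open>The encoder and the decoder\<close>

text \<open>The ancilla state collects the coefficients of the Kraus operators along the slices. It
  is positive as a sum of outer products, and normalization of the Kraus operators gives it trace
  1.\<close>

lemma encoder_form:
  assumes p: "0 < p" and T: "isometry_mat q (p * m) T" and E: "kraus_rep p q K A E"
    and A: "\<And>k. k < K \<Longrightarrow> A k = msum q p (\<lambda>i. h k i \<cdot>\<^sub>m slice p m T i) {..<m}"
  shows "\<exists>\<omega>. density_matrix m \<omega> \<and>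
    (\<forall>\<rho>\<in>carrier_mat p p. E \<rho> = T * kron \<rho> \<omega> * mat_adjoint T)"
proof (intro exI conjI ballI)
  define \<omega> where "\<omega> = mat m m (\<lambda>(i, j). \<Sum>k<K. h k i * cnj (h k j))"
  have \<omega>: "\<omega> \<in> carrier_mat m m" by (simp add: \<omega>_def)
  have Tc: "T \<in> carrier_mat q (p * m)" using T by (simp add: isometry_mat_def)
  have Z: "slice p m T i \<in> carrier_mat q p" for i using Tc by simp
  have "1\<^sub>m p = msum p p (\<lambda>k. mat_adjoint (A k) * A k) {..<K}"
    using E by (simp add: kraus_rep_def)
  also have "\<dots> = msum p p (\<lambda>k. (\<Sum>i<m. h k i * cnj (h k i)) \<cdot>\<^sub>m 1\<^sub>m p) {..<K}"
    by (rule msum_cong)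
      (use span_adjoint_mult_self[OF Z isometry_orthonormal_slices[OF T] A] in simp)
  also have "\<dots> = (\<Sum>k<K. \<Sum>i<m. h k i * cnj (h k i)) \<cdot>\<^sub>m 1\<^sub>m p"
    by (rule msum_smult_const) auto
  \<comment> \<open>Two scalar multiples of the identity are compared at entry
    \<open>(0, 0)\<close>, which exists because \<open>p\<close> is positive.\<close>
  finally have "(1\<^sub>m p :: complex mat) $$ (0, 0)
      = ((\<Sum>k<K. \<Sum>i<m. h k i * cnj (h k i)) \<cdot>\<^sub>m 1\<^sub>m p) $$ (0, 0)" by (rule arg_cong)
  then have "(\<Sum>k<K. \<Sum>i<m. h k i * cnj (h k i)) = 1" using p by simp
  then have "mtrace \<omega> = 1" by (subst (asm) sum.swap) (simp add: mtrace_def \<omega>_def)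
  moreover have "psd m \<omega>"
    by (rule psd_outer_sum[OF \<omega>, where I = "{..<K}" and w = h]) (simp add: \<omega>_def)
  ultimately show "density_matrix m \<omega>" by (simp add: density_matrix_def)
  fix \<rho> :: "complex mat" assume \<rho>: "\<rho> \<in> carrier_mat p p"
  have "E \<rho> = msum q q (\<lambda>k. A k * \<rho> * mat_adjoint (A k)) {..<K}"
    using E \<rho> by (simp add: kraus_rep_def)
  also have "\<dots> = msum q q (\<lambda>ij. (\<Sum>k<K. h k (fst ij) * cnj (h k (snd ij))) \<cdot>\<^sub>m
      (slice p m T (fst ij) * \<rho> * mat_adjoint (slice p m T (snd ij)))) ({..<m} \<times> {..<m})"
    by (rule conj_span_sum[OF Z \<rho>]) (simp add: A)
  also have "\<dots> = T * kron \<rho> \<omega> * mat_adjoint T"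
    unfolding conj_kron[OF Tc \<rho> \<omega>] by (rule msum_cong) (auto simp: \<omega>_def)
  finally show "E \<rho> = T * kron \<rho> \<omega> * mat_adjoint T" .
qed

text \<open>Each column of \<open>X\<close> lies in the kernel of \<sigma>, hence in that of
  \<tau>.\<close>

lemma supported_in_mult_zero:
  assumes sup: "supported_in \<tau> \<sigma>" and \<tau>: "\<tau> \<in> carrier_mat q q" and \<sigma>: "\<sigma> \<in> carrier_mat q q"
    and X: "X \<in> carrier_mat q n" and 0: "\<sigma> * X = 0\<^sub>m q n"
  shows "\<tau> * X = 0\<^sub>m q n"
proof (rule eq_matI)
  fix i j assume "i < dim_row (0\<^sub>m q n :: complex mat)" "j < dim_col (0\<^sub>m q n :: complex mat)"
  then have ij: "i < q" "j < n" by auto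
  have col: "M *\<^sub>v col X j = col (M * X) j" if "M \<in> carrier_mat q q" for M :: "complex mat"
    using that X ij by (intro eq_vecI) auto
  have "col X j \<in> mat_kernel \<sigma>"
    using \<sigma> X ij by (intro mat_kernelI[OF \<sigma>]) (auto simp: col[OF \<sigma>] 0)
  then have "col X j \<in> mat_kernel \<tau>" using sup by (auto simp: supported_in_def)
  then have "col (\<tau> * X) j = 0\<^sub>v q" using mat_kernelD[OF \<tau>] col[OF \<tau>] by simp
  then have "col (\<tau> * X) j $ i = 0" using ij by simp
  then show "(\<tau> * X) $$ (i, j) = 0\<^sub>m q n $$ (i, j)" using ij \<tau> X by simp
qed (use \<tau> X in auto)

text \<open>Everything is compressed to the joint range of the \<open>W i\<close>, on which \<tau>
  lives and where each \<open>B l\<close> acts as a combination of the adjoints of the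
  \<open>W i\<close>. The second conclusion serves to discard the ancilla directions that \<tau>
  does not reach.\<close>

lemma decoder_form:
  assumes p: "0 < p" and E: "kraus_rep p q K A E" and D: "kraus_rep q p L B D"
    and W: "\<And>i. i < r \<Longrightarrow> W i \<in> carrier_mat q p" and orth: "orthonormal_ops p r W"
    and A: "\<And>k. k < K \<Longrightarrow> A k = msum q p (\<lambda>i. g k i \<cdot>\<^sub>m W i) {..<r}"
    and BW: "\<And>i l. i < r \<Longrightarrow> l < L \<Longrightarrow> B l * W i = \<gamma> l i \<cdot>\<^sub>m 1\<^sub>m p"
    and \<rho>: "\<rho> \<in> carrier_mat p p" and \<tau>: "psd q \<tau>" and sup: "supported_in \<tau> (E \<rho>)"
  shows "D \<tau> = msum p p (\<lambda>i. mat_adjoint (W i) * \<tau> * W i) {..<r}"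
    and "X \<in> carrier_mat q p \<Longrightarrow> (\<And>i. i < r \<Longrightarrow> mat_adjoint (W i) * X = 0\<^sub>m p p) \<Longrightarrow> \<tau> * X = 0\<^sub>m q p"
proof -
  have \<tau>c: "\<tau> \<in> carrier_mat q q" using \<tau> by (simp add: psd_def)
  have Ac: "A k \<in> carrier_mat q p" if "k < K" for k using E that by (simp add: kraus_rep_def)
  have Bc: "B l \<in> carrier_mat p q" if "l < L" for l using D that by (simp add: kraus_rep_def)
  have WW: "W i * mat_adjoint (W i) \<in> carrier_mat q q" if "i < r" for i using W[OF that] by auto
  \<comment> \<open>The orthogonal projection onto the joint range of the
    \<open>W i\<close>.\<close>
  define P where "P = msum q q (\<lambda>i. W i * mat_adjoint (W i)) {..<r}"
  have P: "P \<in> carrier_mat q q" by (simp add: P_def)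
  have PX: "P * X = msum q p (\<lambda>i. W i * (mat_adjoint (W i) * X)) {..<r}" if X: "X \<in> carrier_mat q p" for X
  proof -
    have "P * X = msum q p (\<lambda>i. W i * mat_adjoint (W i) * X) {..<r}"
      unfolding P_def by (rule msum_mult[OF X]) (use WW in auto)
    also have "\<dots> = msum q p (\<lambda>i. W i * (mat_adjoint (W i) * X)) {..<r}"
      by (rule msum_cong) (use W X in \<open>auto intro!: assoc_mult_mat[of _ q p _ q _ p]\<close>)
    finally show ?thesis .
  qed
  have "mat_adjoint P = msum q q (\<lambda>i. mat_adjoint (W i * mat_adjoint (W i))) {..<r}"
    unfolding P_def by (rule mat_adjoint_msum) (use WW in auto)
  also have "\<dots> = P"
    unfolding P_def
    by (rule msum_cong) (use W in \<open>auto simp: mat_adjoint_mult[of _ q p _ q]\<close>)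
  finally have P': "mat_adjoint P = P" .
  have PA: "P * A k = A k" if k: "k < K" for k
  proof -
    have "P * A k = msum q p (\<lambda>i. W i * (g k i \<cdot>\<^sub>m 1\<^sub>m p)) {..<r}"
      unfolding PX[OF Ac[OF k]]
      by (rule msum_cong) (simp add: A[OF k] adjoint_mult_msum[OF W orth])
    also have "\<dots> = A k"
      unfolding A[OF k]
      by (rule msum_cong) (use W in \<open>auto simp: mult_smult_distrib[of _ q p _ p] right_mult_one_mat[of _ q p]\<close>)
    finally show ?thesis .
  qed
  have AP: "A k * \<rho> * mat_adjoint (A k) * P = A k * \<rho> * mat_adjoint (A k)" if k: "k < K" for k
  proof -
    have "A k * \<rho> * mat_adjoint (A k) * P = A k * \<rho> * (mat_adjoint (A k) * P)"
      by (rule assoc_mult_mat[of _ q p _ q _ q]) (use Ac[OF k] \<rho> P in auto)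
    also have "mat_adjoint (A k) * P = mat_adjoint (P * A k)"
      using mat_adjoint_mult[OF P Ac[OF k]] P' by simp
    finally show ?thesis using PA[OF k] by simp
  qed
  have E\<rho>: "E \<rho> = msum q q (\<lambda>k. A k * \<rho> * mat_adjoint (A k)) {..<K}"
    using E \<rho> by (simp add: kraus_rep_def)
  have E\<rho>c: "E \<rho> \<in> carrier_mat q q" unfolding E\<rho> by auto
  have "A k * \<rho> * mat_adjoint (A k) \<in> carrier_mat q q" if "k < K" for k
    using Ac[OF that] \<rho> by auto
  then have "E \<rho> * P = msum q q (\<lambda>k. A k * \<rho> * mat_adjoint (A k) * P) {..<K}"
    unfolding E\<rho> by (intro msum_mult[OF P]) simp
  also have "\<dots> = E \<rho>" unfolding E\<rho> by (rule msum_cong) (simp add: AP)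
  finally have EP: "E \<rho> * P = E \<rho>" .
  have diff: "M * (1\<^sub>m q - P) = M - M * P" if "M \<in> carrier_mat q q" for M
    using mult_minus_distrib_mat[OF that one_carrier_mat P] that by simp
  \<comment> \<open>\<open>E \<rho>\<close> kills \<open>1 - P\<close>, and the support condition
    passes this on to \<tau>.\<close>
  have "\<tau> * (1\<^sub>m q - P) = 0\<^sub>m q q"
    by (rule supported_in_mult_zero[OF sup \<tau>c E\<rho>c])
      (use P E\<rho>c in \<open>auto simp: diff EP\<close>)
  then have z: "\<tau> - \<tau> * P = 0\<^sub>m q q" using diff[OF \<tau>c] by simp
  have \<tau>P: "\<tau> * P = \<tau>"
  proof (rule eq_matI)
    fix i j assume "i < dim_row \<tau>" "j < dim_col \<tau>"
    then have ij: "i < q" "j < q" using \<tau>c by auto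
    have "(\<tau> - \<tau> * P) $$ (i, j) = 0" unfolding z using ij by simp
    then show "(\<tau> * P) $$ (i, j) = \<tau> $$ (i, j)"
      using ij \<tau>c P by (simp del: index_mult_mat(1))
  qed (use \<tau>c P in auto)
  \<comment> \<open>Both \<open>P\<close> and \<tau> are Hermitian, so the left version follows by
    taking adjoints.\<close>
  have P\<tau>: "P * \<tau> = \<tau>"
    using arg_cong[OF \<tau>P, of mat_adjoint] by (simp add: mat_adjoint_mult[OF \<tau>c P] P' psd_adjoint[OF \<tau>])
  show "\<tau> * X = 0\<^sub>m q p"
    if X: "X \<in> carrier_mat q p" and 0: "\<And>i. i < r \<Longrightarrow> mat_adjoint (W i) * X = 0\<^sub>m p p"
  proof -
    have "W i * (mat_adjoint (W i) * X) = 0\<^sub>m q p" if "i < r" for i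
      using W[OF that] 0[OF that] by simp
    then have "P * X = 0\<^sub>m q p" unfolding PX[OF X] by (intro eq_matI) auto
    moreover have "\<tau> * X = \<tau> * (P * X)" using assoc_mult_mat[OF \<tau>c P X] \<tau>P by simp
    ultimately show ?thesis using \<tau>c by simp
  qed
  have BP: "B l * P = msum p q (\<lambda>i. \<gamma> l i \<cdot>\<^sub>m mat_adjoint (W i)) {..<r}" if l: "l < L" for l
  proof -
    have "B l * P = msum p q (\<lambda>i. B l * (W i * mat_adjoint (W i))) {..<r}"
      unfolding P_def by (rule mult_msum[OF Bc[OF l]]) (use WW in auto)
    also have "\<dots> = msum p q (\<lambda>i. \<gamma> l i \<cdot>\<^sub>m mat_adjoint (W i)) {..<r}"
    proof (rule msum_cong)
      fix i assume "i \<in> {..<r}"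
      then have i: "i < r" by simp
      have "B l * (W i * mat_adjoint (W i)) = B l * W i * mat_adjoint (W i)"
        using assoc_mult_mat[OF Bc[OF l] W[OF i] mat_adjoint_carrier[OF W[OF i]]] ..
      also have "\<dots> = \<gamma> l i \<cdot>\<^sub>m mat_adjoint (W i)"
        unfolding BW[OF i l] using W[OF i] by (simp add: mult_smult_assoc_mat[of _ p p _ q])
      finally show "B l * (W i * mat_adjoint (W i)) = \<gamma> l i \<cdot>\<^sub>m mat_adjoint (W i)" .
    qed
    finally show ?thesis .
  qed
  have BPB: "B l * \<tau> * mat_adjoint (B l) = (B l * P) * \<tau> * mat_adjoint (B l * P)" if l: "l < L" for l
  proof -
    note b = Bc[OF l] mat_adjoint_carrier[OF Bc[OF l]]
    have left: "B l * P * \<tau> = B l * \<tau>" using assoc_mult_mat[OF b(1) P \<tau>c] P\<tau> by simp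
    have "B l * \<tau> * mat_adjoint (B l * P) = B l * \<tau> * (P * mat_adjoint (B l))"
      using mat_adjoint_mult[OF b(1) P] P' by simp
    also have "\<dots> = B l * \<tau> * P * mat_adjoint (B l)"
      by (rule assoc_mult_mat[symmetric, of _ p q _ q _ p]) (use b P \<tau>c in auto)
    also have "B l * \<tau> * P = B l * \<tau>" using assoc_mult_mat[OF b(1) \<tau>c P] \<tau>P by simp
    finally show ?thesis unfolding left ..
  qed
  \<comment> \<open>Computing \<open>mat_adjoint (W j) * W i\<close> once through the \<gamma> and
    once by orthonormality shows that the cross terms in the decoder sum cancel.\<close>
  have coeff: "(\<Sum>l<L. \<gamma> l i * cnj (\<gamma> l j)) = (if i = j then 1 else 0)" if ij: "i < r" "j < r" for i j
  proof -
    have "(\<Sum>l<L. cnj (\<gamma> l j) * \<gamma> l i) \<cdot>\<^sub>m 1\<^sub>m p = mat_adjoint (W j) * W i"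
      using correctable_inner[OF D W W, of j i "\<lambda>l. \<gamma> l j" "\<lambda>l. \<gamma> l i"] BW ij by simp
    also have "\<dots> = (if i = j then 1\<^sub>m p else 0\<^sub>m p p)"
      using orth ij by (auto simp: orthonormal_ops_def)
    finally have "((\<Sum>l<L. cnj (\<gamma> l j) * \<gamma> l i) \<cdot>\<^sub>m 1\<^sub>m p) $$ (0, 0)
        = (if i = j then 1\<^sub>m p else 0\<^sub>m p p :: complex mat) $$ (0, 0)" by (rule arg_cong)
    then show ?thesis using p by (simp add: mult.commute split: if_splits)
  qed
  let ?Y = "\<lambda>i j. mat_adjoint (W i) * \<tau> * W j"
  have "D \<tau> = msum p p (\<lambda>l. B l * \<tau> * mat_adjoint (B l)) {..<L}"
    using D \<tau>c by (simp add: kraus_rep_def)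
  also have "\<dots> = msum p p (\<lambda>l. (B l * P) * \<tau> * mat_adjoint (B l * P)) {..<L}"
    by (rule msum_cong) (simp add: BPB)
  also have "\<dots> = msum p p (\<lambda>ij. (\<Sum>l<L. \<gamma> l (fst ij) * cnj (\<gamma> l (snd ij))) \<cdot>\<^sub>m
      (mat_adjoint (W (fst ij)) * \<tau> * mat_adjoint (mat_adjoint (W (snd ij))))) ({..<r} \<times> {..<r})"
    by (rule conj_span_sum[OF _ \<tau>c]) (use W BP in auto)
  also have "\<dots> = msum p p (\<lambda>ij. (if fst ij = snd ij then 1 else 0) \<cdot>\<^sub>m ?Y (fst ij) (snd ij)) ({..<r} \<times> {..<r})"
    by (rule msum_cong) (auto simp: coeff)
  also have "\<dots> = msum p p (\<lambda>i. ?Y i i) {..<r}" (is "?M = ?N")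
  proof (rule eq_matI)
    fix a b assume "a < dim_row ?N" "b < dim_col ?N"
    then have ab: "a < p" "b < p" by auto
    have "?M $$ (a, b) = (\<Sum>i<r. \<Sum>j<r. ((if i = j then 1 else 0) \<cdot>\<^sub>m ?Y i j) $$ (a, b))"
      unfolding index_msum[OF ab] by (simp add: sum.cartesian_product case_prod_beta)
    also have "\<dots> = (\<Sum>i<r. \<Sum>j<r. if i = j then ?Y i j $$ (a, b) else 0)"
    proof (intro sum.cong refl)
      fix i j assume "i \<in> {..<r}" "j \<in> {..<r}"
      then have d: "dim_row (?Y i j) = p" "dim_col (?Y i j) = p" using W[of i] W[of j] by auto
      show "((if i = j then 1 else 0) \<cdot>\<^sub>m ?Y i j) $$ (a, b) = (if i = j then ?Y i j $$ (a, b) else 0)"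
        using index_smult_mat(1)[of a "?Y i j" b] d ab by simp
    qed
    also have "\<dots> = ?N $$ (a, b)" unfolding index_msum[OF ab] by simp
    finally show "?M $$ (a, b) = ?N $$ (a, b)" .
  qed auto
  finally show "D \<tau> = msum p p (\<lambda>i. mat_adjoint (W i) * \<tau> * W i) {..<r}" .
qed

theorem theorem2p1:
  fixes p q :: nat
    and E D :: "complex mat \<Rightarrow> complex mat"
    and V :: "complex mat"
  assumes "p > 0" and "q > 0"
    and embedding: "isometry_mat q (p * (q div p)) V"
    and "cptp p q E"
    and "cptp q p D"
    and inverse: "\<And>\<rho>. density_matrix p \<rho> \<Longrightarrow> D (E \<rho>) = \<rho>"
  shows "\<exists>\<omega> U. density_matrix (q div p) \<omega> \<and> unitary_mat q U \<and>
           (\<forall>\<rho>. density_matrix p \<rho> \<longrightarrow> E \<rho> = U * embed_op V (kron \<rho> \<omega>) * mat_adjoint U) \<and>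
           (\<forall>\<rho> \<tau>. density_matrix p \<rho> \<and> density_matrix q \<tau> \<and> supported_in \<tau> (E \<rho>) \<longrightarrow>
              D \<tau> = ptrace2 p (q div p) (restrict_op V (mat_adjoint U * \<tau> * U)))"
proof -
  obtain K A where E: "kraus_rep p q K A E" using cptp_imp_kraus_rep[OF assms(4)] by blast
  obtain L B where D: "kraus_rep q p L B D" using cptp_imp_kraus_rep[OF assms(5)] by blast
  have A: "k < K \<Longrightarrow> A k \<in> carrier_mat q p" and B: "l < L \<Longrightarrow> B l \<in> carrier_mat p q" for k l
    using E D by (auto simp: kraus_rep_def)
  \<comment> \<open>The space in which Gram-Schmidt takes place: it contains all \<open>A k\<close>,
    and its operators have scalar products with each other.\<close>
  define S where "S = correctable p q L B"
  have "A k \<in> S" if "k < K" for k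
    using A[OF that] kraus_left_inverse_scalar[OF E D inverse that] by (auto simp: S_def correctable_def)
  moreover have "\<exists>c. mat_adjoint X * Y = c \<cdot>\<^sub>m 1\<^sub>m p" if "X \<in> S" "Y \<in> S" for X Y
  proof -
    obtain c d where "\<forall>l<L. B l * X = c l \<cdot>\<^sub>m 1\<^sub>m p" "\<forall>l<L. B l * Y = d l \<cdot>\<^sub>m 1\<^sub>m p"
      using \<open>X \<in> S\<close> \<open>Y \<in> S\<close> unfolding S_def correctable_def mem_Collect_eq by metis
    with correctable_inner[OF D, of X Y c d] that show ?thesis by (auto simp: S_def correctable_def)
  qed
  ultimately obtain r W g where W: "\<And>i. i < r \<Longrightarrow> W i \<in> S" and orth: "orthonormal_ops p r W"
    and AW: "\<And>k. k < K \<Longrightarrow> A k = msum q p (\<lambda>i. g k i \<cdot>\<^sub>m W i) {..<r}"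
    using operator_gram_schmidt[of p S q K A] \<open>p > 0\<close> correctable_add[of L B p q] correctable_smult[of L B p q] B
    unfolding S_def by (auto simp: correctable_def)
  have Wc: "W i \<in> carrier_mat q p" if "i < r" for i using W[OF that] by (simp add: S_def correctable_def)
  have "\<forall>l i. \<exists>c. i < r \<longrightarrow> l < L \<longrightarrow> B l * W i = c \<cdot>\<^sub>m 1\<^sub>m p"
    using W unfolding S_def correctable_def by blast
  then obtain \<gamma> where BW: "\<And>i l. i < r \<Longrightarrow> l < L \<Longrightarrow> B l * W i = \<gamma> l i \<cdot>\<^sub>m 1\<^sub>m p" by metis
  define m where "m = q div p"
  obtain U where rm: "r \<le> m" and U: "unitary_mat q U"
    and UW: "\<And>i. i < r \<Longrightarrow> slice p m (U * V) i = W i"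
    using align_slices[OF \<open>p > 0\<close> embedding Wc orth] unfolding m_def by blast
  \<comment> \<open>With this composite, both required formulas become statements about conjugation
    by \<open>T\<close> or its adjoint, to which the slice lemmas apply.\<close>
  define T where "T = U * V"
  have Uc: "U \<in> carrier_mat q q" "mat_adjoint U \<in> carrier_mat q q" "mat_adjoint U * U = 1\<^sub>m q"
    and Vc: "V \<in> carrier_mat q (p * m)" "mat_adjoint V \<in> carrier_mat (p * m) q"
    using U embedding by (auto simp: unitary_mat_def isometry_mat_def m_def)
  have Tc: "T \<in> carrier_mat q (p * m)" unfolding T_def using Uc Vc by simp
  have T': "mat_adjoint T = mat_adjoint V * mat_adjoint U"
    unfolding T_def by (rule mat_adjoint_mult[OF Uc(1) Vc(1)])
  have "mat_adjoint T * T = mat_adjoint V * (mat_adjoint U * (U * V))"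
    unfolding T' unfolding T_def
    by (rule assoc_mult_mat[OF Vc(2) Uc(2)]) (use Uc Vc in auto)
  also have "mat_adjoint U * (U * V) = V"
    using assoc_mult_mat[OF Uc(2,1) Vc(1)] Uc(3) Vc(1) by simp
  finally have T: "isometry_mat q (p * m) T"
    using Tc embedding by (simp add: isometry_mat_def m_def)
  \<comment> \<open>Only the first \<open>r\<close> slices of \<open>T\<close> are prescribed as the
    \<open>W i\<close>; the remaining ancilla indices receive coefficient 0.\<close>
  have AT: "A k = msum q p (\<lambda>i. (if i < r then g k i else 0) \<cdot>\<^sub>m slice p m T i) {..<m}" (is "_ = ?R")
    if k: "k < K" for k
  proof (rule eq_matI)
    fix x a assume "x < dim_row ?R" "a < dim_col ?R"
    then have xa: "x < q" "a < p" by auto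
    have "A k $$ (x, a) = (\<Sum>i<r. ((if i < r then g k i else 0) \<cdot>\<^sub>m slice p m T i) $$ (x, a))"
      using xa by (simp add: AW[OF k] UW T_def)
    also have "\<dots> = (\<Sum>i<m. ((if i < r then g k i else 0) \<cdot>\<^sub>m slice p m T i) $$ (x, a))"
      using xa rm Tc by (intro sum.mono_neutral_left) (auto simp: slice_def)
    finally show "A k $$ (x, a) = ?R $$ (x, a)" using xa by simp
  qed (use A[OF k] in auto)
  obtain \<omega> where \<omega>: "density_matrix m \<omega>"
    and ET: "\<And>\<rho>. \<rho> \<in> carrier_mat p p \<Longrightarrow> E \<rho> = T * kron \<rho> \<omega> * mat_adjoint T"
    using encoder_form[OF \<open>p > 0\<close> T E AT] by blast
  have \<omega>c: "\<omega> \<in> carrier_mat m m" using \<omega> by (simp add: density_matrix_def psd_def)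
  have "E \<rho> = U * embed_op V (kron \<rho> \<omega>) * mat_adjoint U" if "density_matrix p \<rho>" for \<rho>
  proof -
    have \<rho>: "\<rho> \<in> carrier_mat p p" using that by (simp add: density_matrix_def psd_def)
    have K: "kron \<rho> \<omega> \<in> carrier_mat (p * m) (p * m)" using \<rho> \<omega>c by (simp add: kron_def)
    have "T * kron \<rho> \<omega> * mat_adjoint T = T * kron \<rho> \<omega> * mat_adjoint V * mat_adjoint U"
      unfolding T' by (rule assoc_mult_mat[symmetric, of _ q "p * m" _ q _ q]) (use Tc K Vc Uc in auto)
    also have "T * kron \<rho> \<omega> * mat_adjoint V = U * (V * kron \<rho> \<omega>) * mat_adjoint V"
      unfolding T_def using assoc_mult_mat[OF Uc(1) Vc(1) K] by simp
    also have "\<dots> = U * embed_op V (kron \<rho> \<omega>)"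
      unfolding embed_op_def by (rule assoc_mult_mat[OF Uc(1) _ Vc(2)]) (use Vc K in auto)
    finally show ?thesis using ET[OF \<rho>] by simp
  qed
  moreover have "D \<tau> = ptrace2 p m (restrict_op V (mat_adjoint U * \<tau> * U))"
    if "density_matrix p \<rho>" "density_matrix q \<tau>" and sup: "supported_in \<tau> (E \<rho>)" for \<rho> \<tau>
  proof -
    have \<rho>: "\<rho> \<in> carrier_mat p p" and \<tau>: "psd q \<tau>" and \<tau>c: "\<tau> \<in> carrier_mat q q"
      using that by (simp_all add: density_matrix_def psd_def)
    have D\<tau>: "D \<tau> = msum p p (\<lambda>i. mat_adjoint (W i) * \<tau> * W i) {..<r}"
      by (rule decoder_form(1)[OF \<open>p > 0\<close> E D Wc orth AW BW \<rho> \<tau> sup])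
    have \<tau>X: "\<tau> * X = 0\<^sub>m q p"
      if "X \<in> carrier_mat q p" "\<And>i. i < r \<Longrightarrow> mat_adjoint (W i) * X = 0\<^sub>m p p" for X
      by (rule decoder_form(2)[OF \<open>p > 0\<close> E D Wc orth AW BW \<rho> \<tau> sup that])
    let ?Z = "slice p m T"
    have Z: "?Z i \<in> carrier_mat q p" for i using Tc by simp
    \<comment> \<open>Slices of index at least \<open>r\<close> are orthogonal to all
      \<open>W j\<close>, so \<tau> kills them and the partial trace over all \<open>m\<close>
      ancilla indices reduces to the \<open>r\<close> terms of the decoder.\<close>
    have \<tau>Z: "mat_adjoint (?Z i) * \<tau> * ?Z i = 0\<^sub>m p p" if i: "r \<le> i" "i < m" for i
    proof -
      have "mat_adjoint (W j) * ?Z i = 0\<^sub>m p p" if "j < r" for j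
        using isometry_orthonormal_slices[OF T] that i UW[OF that] unfolding T_def orthonormal_ops_def
        by (metis less_le_trans linorder_not_le rm)
      then have "\<tau> * ?Z i = 0\<^sub>m q p" by (rule \<tau>X[OF Z])
      then show ?thesis
        using assoc_mult_mat[OF mat_adjoint_carrier[OF Z] \<tau>c Z, of i i]
          right_mult_zero_mat[OF mat_adjoint_carrier[OF Z]] by simp
    qed
    have "restrict_op V (mat_adjoint U * \<tau> * U) = mat_adjoint T * \<tau> * T"
    proof -
      have TUV: "mat_adjoint T * \<tau> * T = mat_adjoint T * \<tau> * U * V"
        unfolding T_def by (rule assoc_mult_mat[symmetric, of _ "p * m" q _ q _ "p * m"])
          (use Tc \<tau>c Uc Vc in \<open>auto simp: T_def[symmetric]\<close>)
      have T\<tau>: "mat_adjoint T * \<tau> = mat_adjoint V * (mat_adjoint U * \<tau>)"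
        unfolding T' by (rule assoc_mult_mat[OF Vc(2) Uc(2) \<tau>c])
      have assoc: "mat_adjoint V * (mat_adjoint U * \<tau>) * U = mat_adjoint V * (mat_adjoint U * \<tau> * U)"
        by (rule assoc_mult_mat[OF Vc(2) _ Uc(1)]) (use Uc \<tau>c in auto)
      show ?thesis unfolding restrict_op_def TUV unfolding T\<tau> assoc ..
    qed
    then have "ptrace2 p m (restrict_op V (mat_adjoint U * \<tau> * U))
        = msum p p (\<lambda>i. mat_adjoint (?Z i) * \<tau> * ?Z i) {..<m}"
      using ptrace2_conj[OF Tc \<tau>c] by simp
    also have "\<dots> = msum p p (\<lambda>i. mat_adjoint (?Z i) * \<tau> * ?Z i) {..<r}" (is "?M = ?N")
    proof (rule eq_matI)
      fix a b assume "a < dim_row ?N" "b < dim_col ?N"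
      then have ab: "a < p" "b < p" by auto
      show "?M $$ (a, b) = ?N $$ (a, b)"
        unfolding index_msum[OF ab] by (rule sum.mono_neutral_right) (use rm ab in \<open>auto simp: \<tau>Z\<close>)
    qed auto
    also have "\<dots> = D \<tau>" unfolding D\<tau> by (rule msum_cong) (simp add: UW T_def)
    finally show ?thesis ..
  qed
  ultimately show ?thesis using \<omega> U unfolding m_def by blast
qed

end
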